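(* Let $n\ge 3$. The alternating group $D_n^+$ of type D is isomorphic to the group generated by $a_1,\dots,a_{n-1}$ with the defining relations $$\left\{\begin{array}{ll} a_i^3=1 & \text{for } i=1,\dots,n-1,\\ (a_1a_i)^2=1 & \text{for } i=2,\dots,n-1,\\ (a_2^2a_i)^2=1 & \text{for } i=3,\dots,n-1,\\ (a_ia_j)^2=1 & \text{for } i,j=3,\dots,n-1 \text{ such that } i<j. \end{array}\right.$$ Identifying $D_n^+$ with the subgroup $\{(g,\pi):\epsilon_{C_2^n}(g)=1,\ \epsilon_0(\pi)=1\}$ of $C_2\wr\mathfrak{S}_n$ (see the context), the isomorphism is given by $a_1\mapsto\bigl(\gamma^{(1)}\gamma^{(2)},(1,2,3)\bigr)$, $a_2\mapsto\bigl(\gamma^{(1)}\gamma^{(2)},(1,3,2)\bigr)$ and $a_i\mapsto\bigl(\gamma^{(1)}\gamma^{(2)},(1,2,i+1)\bigr)$ for $i=3,\dots,n-1$.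
   Context: The Coxeter group $D_n$ is generated by $s_0,\dots,s_{n-1}$ with defining relations $s_i^2=1$ for $i=0,\dots,n-1$; $s_0s_2s_0=s_2s_0s_2$; $s_is_{i+1}s_i=s_{i+1}s_is_{i+1}$ for $i=1,\dots,n-2$; $s_0s_1=s_1s_0$; $s_0s_i=s_is_0$ for $i=3,\dots,n-1$; $s_is_j=s_js_i$ for $i,j=1,\dots,n-1$ with $|i-j|>1$. The alternating group $D_n^+$ is the kernel of the homomorphism $D_n\to\{-1,1\}$ with $s_i\mapsto-1$ for all $i$. Let $C_2$ be the cyclic group of order $2$ with generator $\gamma$, and let $\gamma^{(i)}\in C_2^n$ be the element with $\gamma$ in position $i$ and the unit element elsewhere. $\mathfrak{S}_n$ is the symmetric group on $\{1,\dots,n\}$; products of permutations are composed right to left ($\pi\sigma$ means $\sigma$ first, then $\pi$), and $(a,b,c)$ denotes the cycle $a\mapsto b\mapsto c\mapsto a$. The wreath product $C_2\wr\mathfrak{S}_n$ consists of pairs $(g,\pi)$, $g\in C_2^n$, $\pi\in\mathfrak{S}_n$, with $(g,\pi)(g',\pi')=(g\cdot\pi(g'),\pi\pi')$ where $\pi(\gamma^{(i)})=\gamma^{(\pi(i))}$. Let $\epsilon_0$ be the sign character of $\mathfrak{S}_n$ and $\epsilon_{C_2^n}:C_2^n\to\{-1,1\}$ the homomorphism with $\epsilon_{C_2^n}(\gamma^{(i)})=-1$ for all $i$. The group $D_n$ is identified with the subgroup of $C_2\wr\mathfrak{S}_n$ of pairs $(g,\pi)$ with $\epsilon_{C_2^n}(g)=1$,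 by $s_0\mapsto(\gamma^{(1)}\gamma^{(2)},(1,2))$ and $s_i\mapsto(1,(i,i+1))$ for $i=1,\dots,n-1$; then $D_n^+$ corresponds to the pairs $(g,\pi)$ with $\epsilon_{C_2^n}(g)=1$ and $\epsilon_0(\pi)=1$. *)

theory Defs
  imports "HOL-Algebra.Algebra"
begin

section \<open>Groups given by generators and defining relations\<close>

text \<open>A letter \<open>(x, True)\<close> stands for the generator \<open>x\<close>, a letter \<open>(x, False)\<close> for its formal inverse.\<close>

type_synonym 'a gword = "('a \<times> bool) list"

definition gwords :: "'a set \<Rightarrow> 'a gword set"
  where "gwords S = lists (S \<times> UNIV)"

text \<open>The least congruence on the words over \<open>S\<close> that contains the free cancellations
  and identifies \<open>l\<close> with \<open>r\<close> for every pair \<open>(l, r) \<in> R\<close>.\<close>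

inductive gword_equiv :: "'a set \<Rightarrow> ('a gword \<times> 'a gword) set \<Rightarrow> 'a gword \<Rightarrow> 'a gword \<Rightarrow> bool"
  for S R where
  refl: "w \<in> gwords S \<Longrightarrow> gword_equiv S R w w"
| sym: "gword_equiv S R v w \<Longrightarrow> gword_equiv S R w v"
| trans: "gword_equiv S R u v \<Longrightarrow> gword_equiv S R v w \<Longrightarrow> gword_equiv S R u w"
| append: "gword_equiv S R u u' \<Longrightarrow> gword_equiv S R v v' \<Longrightarrow> gword_equiv S R (u @ v) (u' @ v')"
| cancel: "x \<in> S \<Longrightarrow> gword_equiv S R [(x, b), (x, \<not> b)] []"
| rel: "(l, r) \<in> R \<Longrightarrow> l \<in> gwords S \<Longrightarrow> r \<in> gwords S \<Longrightarrow> gword_equiv S R l r"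

definition gword_class :: "'a set \<Rightarrow> ('a gword \<times> 'a gword) set \<Rightarrow> 'a gword \<Rightarrow> 'a gword set"
  where "gword_class S R w = {v. gword_equiv S R w v}"

definition presented_group :: "'a set \<Rightarrow> ('a gword \<times> 'a gword) set \<Rightarrow> 'a gword set monoid"
  where "presented_group S R =
    \<lparr> carrier = gword_class S R ` gwords S,
      monoid.mult = (\<lambda>U V. {w. \<exists>x\<in>U. \<exists>y\<in>V. gword_equiv S R (x @ y) w}),
      one = gword_class S R [] \<rparr>"

definition gen :: "'a \<Rightarrow> 'a gword"
  where "gen x = [(x, True)]"

definition gpow :: "'a gword \<Rightarrow> nat \<Rightarrow> 'a gword"
  where "gpow w k = concat (replicate k w)"

primrec gword_eval :: "('b, 'm) monoid_scheme \<Rightarrow> ('a \<Rightarrow> 'b) \<Rightarrow> 'a gword \<Rightarrow> 'b"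
  where
    "gword_eval G f [] = \<one>\<^bsub>G\<^esub>"
  | "gword_eval G f (p # w) =
      (if snd p then f (fst p) else inv\<^bsub>G\<^esub> f (fst p)) \<otimes>\<^bsub>G\<^esub> gword_eval G f w"

text \<open>The homomorphism from a presented group to \<open>G\<close> that sends each generator \<open>x\<close> to \<open>f x\<close>.
  The choice of the representative is irrelevant when \<open>f\<close> respects the relations;
  see \<open>presented_hom_in_hom\<close> below.\<close>

definition presented_hom :: "('b, 'm) monoid_scheme \<Rightarrow> ('a \<Rightarrow> 'b) \<Rightarrow> 'a gword set \<Rightarrow> 'b"
  where "presented_hom G f U = gword_eval G f (SOME w. w \<in> U)"

lemma gwords_Nil [simp]: "[] \<in> gwords S"
  by (simp add: gwords_def)

lemma gwords_Cons [simp]: "p # w \<in> gwords S \<longleftrightarrow> fst p \<in> S \<and> w \<in> gwords S"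
  by (cases p) (auto simp: gwords_def)

lemma gwords_append [simp]: "u @ v \<in> gwords S \<longleftrightarrow> u \<in> gwords S \<and> v \<in> gwords S"
  by (auto simp: gwords_def)

lemma gword_equiv_gwords: "gword_equiv S R u v \<Longrightarrow> u \<in> gwords S \<and> v \<in> gwords S"
  by (induction rule: gword_equiv.induct) auto

lemma gword_class_eq_iff:
  assumes "u \<in> gwords S"
  shows "gword_class S R u = gword_class S R v \<longleftrightarrow> gword_equiv S R u v"
  using assms unfolding gword_class_def
  by (auto intro: gword_equiv.refl gword_equiv.sym gword_equiv.trans)

lemma presented_group_mult:
  assumes "u \<in> gwords S" "v \<in> gwords S"
  shows "gword_class S R u \<otimes>\<^bsub>presented_group S R\<^esub> gword_class S R v = gword_class S R (u @ v)"
  using assms unfolding presented_group_def gword_class_def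
  by (auto intro: gword_equiv.refl gword_equiv.append gword_equiv.trans)

lemma gword_left_inverse:
  assumes "w \<in> gwords S"
  shows "\<exists>w'\<in>gwords S. gword_equiv S R (w' @ w) []"
  using assms
proof (induction w)
  case Nil
  then show ?case by (intro bexI[of _ "[]"]) (auto intro: gword_equiv.refl)
next
  case (Cons p w)
  obtain x b where p: "p = (x, b)" by force
  from Cons obtain w' where w': "w' \<in> gwords S" "gword_equiv S R (w' @ w) []" by auto
  have x: "x \<in> S" and w: "w \<in> gwords S" using Cons.prems p by auto
  have "gword_equiv S R ([(x, \<not> b), (x, b)]) []"
    using gword_equiv.cancel[OF x, of R "\<not> b"] by simp
  then have "gword_equiv S R ((w' @ [(x, \<not> b), (x, b)]) @ w) ((w' @ []) @ w)"
    by (intro gword_equiv.append gword_equiv.refl w w')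
  then have "gword_equiv S R ((w' @ [(x, \<not> b)]) @ p # w) []"
    using gword_equiv.trans w'(2) p by fastforce
  then show ?case using w' x by (intro bexI[of _ "w' @ [(x, \<not> b)]"]) auto
qed

lemma presented_group_is_group: "group (presented_group S R)"
proof (rule groupI)
  let ?P = "presented_group S R"
  have car: "carrier ?P = gword_class S R ` gwords S" and one: "\<one>\<^bsub>?P\<^esub> = gword_class S R []"
    by (simp_all add: presented_group_def)
  show "\<one>\<^bsub>?P\<^esub> \<in> carrier ?P" by (simp add: car one)
  fix x assume "x \<in> carrier ?P"
  then obtain u where u: "u \<in> gwords S" "x = gword_class S R u" by (auto simp: car)
  show "\<one>\<^bsub>?P\<^esub> \<otimes>\<^bsub>?P\<^esub> x = x" using u by (simp add: one presented_group_mult)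
  obtain u' where u': "u' \<in> gwords S" "gword_equiv S R (u' @ u) []"
    using gword_left_inverse u by blast
  then show "\<exists>y\<in>carrier ?P. y \<otimes>\<^bsub>?P\<^esub> x = \<one>\<^bsub>?P\<^esub>"
    using u by (intro bexI[of _ "gword_class S R u'"])
      (auto simp: car one presented_group_mult gword_class_eq_iff)
  fix y assume "y \<in> carrier ?P"
  then obtain v where v: "v \<in> gwords S" "y = gword_class S R v" by (auto simp: car)
  show "x \<otimes>\<^bsub>?P\<^esub> y \<in> carrier ?P" using u v by (simp add: car presented_group_mult)
  fix z assume "z \<in> carrier ?P"
  then obtain w where w: "w \<in> gwords S" "z = gword_class S R w" by (auto simp: car)
  show "x \<otimes>\<^bsub>?P\<^esub> y \<otimes>\<^bsub>?P\<^esub> z = x \<otimes>\<^bsub>?P\<^esub> (y \<otimes>\<^bsub>?P\<^esub> z)"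
    using u v w by (simp add: presented_group_mult)
qed

lemma (in group) gword_eval_closed:
  assumes "f ` S \<subseteq> carrier G" "w \<in> gwords S"
  shows "gword_eval G f w \<in> carrier G"
  using assms(2) by (induction w) (use assms(1) in auto)

lemma (in group) gword_eval_append:
  assumes "f ` S \<subseteq> carrier G" "u \<in> gwords S" "v \<in> gwords S"
  shows "gword_eval G f (u @ v) = gword_eval G f u \<otimes> gword_eval G f v"
  using assms(2)
proof (induction u)
  case Nil
  then show ?case using gword_eval_closed[OF assms(1,3)] by simp
next
  case (Cons p u)
  moreover have "f (fst p) \<in> carrier G" using Cons.prems assms(1) by auto
  moreover have "gword_eval G f u \<in> carrier G" "gword_eval G f v \<in> carrier G"
    using gword_eval_closed assms Cons.prems by auto
  ultimately show ?case by (auto simp: m_assoc)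
qed

lemma (in group) gword_eval_equiv:
  assumes f: "f ` S \<subseteq> carrier G"
    and R: "\<And>l r. (l, r) \<in> R \<Longrightarrow> gword_eval G f l = gword_eval G f r"
    and "gword_equiv S R u v"
  shows "gword_eval G f u = gword_eval G f v"
  using assms(3)
proof (induction rule: gword_equiv.induct)
  case (append u u' v v')
  then show ?case
    using gword_eval_append[OF f] by (metis gword_equiv_gwords)
next
  case (cancel x b)
  then have "f x \<in> carrier G" using f by auto
  then show ?case by (cases b) auto
qed (auto simp: R)

lemma (in group) presented_hom_class:
  assumes "f ` S \<subseteq> carrier G"
    and "\<And>l r. (l, r) \<in> R \<Longrightarrow> gword_eval G f l = gword_eval G f r"
    and "w \<in> gwords S"
  shows "presented_hom G f (gword_class S R w) = gword_eval G f w"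
proof -
  have "w \<in> gword_class S R w"
    using assms(3) by (simp add: gword_class_def gword_equiv.refl)
  then have "(SOME v. v \<in> gword_class S R w) \<in> gword_class S R w"
    by (rule someI[of "\<lambda>v. v \<in> gword_class S R w"])
  then show ?thesis
    unfolding presented_hom_def using gword_eval_equiv[OF assms(1,2)]
    by (simp add: gword_class_def)
qed

lemma (in group) presented_hom_in_hom:
  assumes "f ` S \<subseteq> carrier G"
    and "\<And>l r. (l, r) \<in> R \<Longrightarrow> gword_eval G f l = gword_eval G f r"
  shows "presented_hom G f \<in> hom (presented_group S R) G"
    and "x \<in> S \<Longrightarrow> presented_hom G f (gword_class S R (gen x)) = f x"
proof -
  note c = presented_hom_class[OF assms]
  show "presented_hom G f \<in> hom (presented_group S R) G"
  proof (rule homI)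
    fix U V assume "U \<in> carrier (presented_group S R)" "V \<in> carrier (presented_group S R)"
    then obtain u v where "u \<in> gwords S" "U = gword_class S R u" "v \<in> gwords S" "V = gword_class S R v"
      by (auto simp: presented_group_def)
    then show "presented_hom G f U \<in> carrier G"
      and "presented_hom G f (U \<otimes>\<^bsub>presented_group S R\<^esub> V)
            = presented_hom G f U \<otimes> presented_hom G f V"
      using c gword_eval_closed[OF assms(1)] gword_eval_append[OF assms(1)]
      by (auto simp: presented_group_mult)
  qed
  show "x \<in> S \<Longrightarrow> presented_hom G f (gword_class S R (gen x)) = f x"
    using assms(1) by (subst c) (auto simp: gen_def)
qed


section \<open>The Coxeter group of type D and its alternating subgroup\<close>

definition coxeter_D_rels :: "nat \<Rightarrow> (nat gword \<times> nat gword) set"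
  where "coxeter_D_rels n =
      {(gpow (gen i) 2, []) | i. i \<in> {0..n-1}}
    \<union> {(gen 0 @ gen 2 @ gen 0, gen 2 @ gen 0 @ gen 2)}
    \<union> {(gen i @ gen (i+1) @ gen i, gen (i+1) @ gen i @ gen (i+1)) | i. i \<in> {1..n-2}}
    \<union> {(gen 0 @ gen 1, gen 1 @ gen 0)}
    \<union> {(gen 0 @ gen i, gen i @ gen 0) | i. i \<in> {3..n-1}}
    \<union> {(gen i @ gen j, gen j @ gen i) | i j.
          i \<in> {1..n-1} \<and> j \<in> {1..n-1} \<and> \<bar>int i - int j\<bar> > 1}"

definition coxeter_D :: "nat \<Rightarrow> nat gword set monoid"
  where "coxeter_D n = presented_group {0..n-1} (coxeter_D_rels n)"

definition coxeter_D_gen :: "nat \<Rightarrow> nat \<Rightarrow> nat gword set"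
  where "coxeter_D_gen n i = gword_class {0..n-1} (coxeter_D_rels n) (gen i)"

definition coxeter_D_sign :: "nat gword set \<Rightarrow> int"
  where "coxeter_D_sign = presented_hom sign_img (\<lambda>i. -1)"

definition alternating_D :: "nat \<Rightarrow> nat gword set monoid"
  where "alternating_D n =
    (coxeter_D n)\<lparr>carrier := kernel (coxeter_D n) sign_img coxeter_D_sign\<rparr>"

lemma coxeter_D_sign_hom:
  "coxeter_D_sign \<in> hom (coxeter_D n) sign_img"
  "i \<in> {0..n-1} \<Longrightarrow> coxeter_D_sign (coxeter_D_gen n i) = -1"
proof -
  interpret group sign_img by (rule sign_img_is_group)
  have "(\<lambda>i. -1) ` {0..n-1} \<subseteq> carrier sign_img" by (auto simp: sign_img_def)
  moreover have "gword_eval sign_img (\<lambda>i. -1) l = gword_eval sign_img (\<lambda>i. -1) r"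
    if "(l, r) \<in> coxeter_D_rels n" for l r
    using that
    by (auto simp: coxeter_D_rels_def gen_def gpow_def sign_img_def numeral_2_eq_2)
  ultimately have "coxeter_D_sign \<in> hom (coxeter_D n) sign_img
      \<and> (i \<in> {0..n-1} \<longrightarrow> coxeter_D_sign (coxeter_D_gen n i) = -1)"
    unfolding coxeter_D_sign_def coxeter_D_def coxeter_D_gen_def
    using presented_hom_in_hom[of "\<lambda>i. -1" "{0..n-1}" "coxeter_D_rels n"] by blast
  then show "coxeter_D_sign \<in> hom (coxeter_D n) sign_img"
    and "i \<in> {0..n-1} \<Longrightarrow> coxeter_D_sign (coxeter_D_gen n i) = -1"
    by auto
qed


section \<open>The wreath product of the cyclic group of order 2 with the symmetric group\<close>

definition C2_pow :: "nat \<Rightarrow> (nat \<Rightarrow> int) monoid"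
  where "C2_pow n = product_group {1..n} (\<lambda>_. integer_mod_group 2)"

text \<open>\<open>C\<^sub>2\<close> is the additive group of integers modulo 2, so its generator is \<open>1\<close> and its unit \<open>0\<close>.\<close>

definition gamma :: "nat \<Rightarrow> nat \<Rightarrow> nat \<Rightarrow> int"
  where "gamma n i = (\<lambda>j\<in>{1..n}. if j = i then 1 else 0)"

text \<open>The action with \<open>\<pi>(\<gamma>\<^sup>(\<^sup>i\<^sup>)) = \<gamma>\<^sup>(\<^sup>\<pi>\<^sup>(\<^sup>i\<^sup>)\<^sup>)\<close>;
  see \<open>perm_act_gamma\<close> below.\<close>

definition perm_act :: "nat \<Rightarrow> (nat \<Rightarrow> nat) \<Rightarrow> (nat \<Rightarrow> int) \<Rightarrow> nat \<Rightarrow> int"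
  where "perm_act n \<pi> g = (\<lambda>j\<in>{1..n}. g (inv' \<pi> j))"

lemma perm_act_gamma:
  assumes "\<pi> permutes {1..n}"
  shows "perm_act n \<pi> (gamma n i) = gamma n (\<pi> i)"
proof
  fix j
  have "inv' \<pi> j \<in> {1..n} \<longleftrightarrow> j \<in> {1..n}"
    using permutes_in_image[OF permutes_inv[OF assms]] .
  moreover have "inv' \<pi> j = i \<longleftrightarrow> j = \<pi> i"
    using permutes_inv_eq[OF assms] by metis
  ultimately show "perm_act n \<pi> (gamma n i) j = gamma n (\<pi> i) j"
    by (auto simp: perm_act_def gamma_def)
qed

definition C2_wreath :: "nat \<Rightarrow> ((nat \<Rightarrow> int) \<times> (nat \<Rightarrow> nat)) monoid"
  where "C2_wreath n =
    \<lparr> carrier = carrier (C2_pow n) \<times> carrier (sym_group n),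
      monoid.mult = (\<lambda>(g, \<pi>) (g', \<pi>').
        (g \<otimes>\<^bsub>C2_pow n\<^esub> perm_act n \<pi> g', \<pi> \<otimes>\<^bsub>sym_group n\<^esub> \<pi>')),
      one = (\<one>\<^bsub>C2_pow n\<^esub>, \<one>\<^bsub>sym_group n\<^esub>) \<rparr>"

definition C2_pow_sign :: "nat \<Rightarrow> (nat \<Rightarrow> int) \<Rightarrow> int"
  where "C2_pow_sign n g = (\<Prod>i\<in>{1..n}. if g i = 1 then -1 else 1)"

definition wreath_D :: "nat \<Rightarrow> ((nat \<Rightarrow> int) \<times> (nat \<Rightarrow> nat)) monoid"
  where "wreath_D n = (C2_wreath n)
    \<lparr>carrier := {(g, \<pi>) \<in> carrier (C2_wreath n). C2_pow_sign n g = 1}\<rparr>"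

definition wreath_D_plus :: "nat \<Rightarrow> ((nat \<Rightarrow> int) \<times> (nat \<Rightarrow> nat)) monoid"
  where "wreath_D_plus n = (C2_wreath n)
    \<lparr>carrier := {(g, \<pi>) \<in> carrier (C2_wreath n). C2_pow_sign n g = 1 \<and> sign \<pi> = 1}\<rparr>"

definition coxeter_D_gen_image :: "nat \<Rightarrow> nat \<Rightarrow> (nat \<Rightarrow> int) \<times> (nat \<Rightarrow> nat)"
  where "coxeter_D_gen_image n i =
    (if i = 0 then (gamma n 1 \<otimes>\<^bsub>C2_pow n\<^esub> gamma n 2, cycle_of_list [1, 2])
     else (\<one>\<^bsub>C2_pow n\<^esub>, cycle_of_list [i, i+1]))"


section \<open>The presentation of the alternating group\<close>

definition alt_pres_rels :: "nat \<Rightarrow> (nat gword \<times> nat gword) set"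
  where "alt_pres_rels n =
      {(gpow (gen i) 3, []) | i. i \<in> {1..n-1}}
    \<union> {(gpow (gen 1 @ gen i) 2, []) | i. i \<in> {2..n-1}}
    \<union> {(gpow (gpow (gen 2) 2 @ gen i) 2, []) | i. i \<in> {3..n-1}}
    \<union> {(gpow (gen i @ gen j) 2, []) | i j. i \<in> {3..n-1} \<and> j \<in> {3..n-1} \<and> i < j}"

definition alt_pres :: "nat \<Rightarrow> nat gword set monoid"
  where "alt_pres n = presented_group {1..n-1} (alt_pres_rels n)"

definition alt_pres_gen :: "nat \<Rightarrow> nat \<Rightarrow> nat gword set"
  where "alt_pres_gen n i = gword_class {1..n-1} (alt_pres_rels n) (gen i)"

definition alt_pres_gen_image :: "nat \<Rightarrow> nat \<Rightarrow> (nat \<Rightarrow> int) \<times> (nat \<Rightarrow> nat)"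
  where "alt_pres_gen_image n i =
    (gamma n 1 \<otimes>\<^bsub>C2_pow n\<^esub> gamma n 2,
     if i = 1 then cycle_of_list [1, 2, 3]
     else if i = 2 then cycle_of_list [1, 3, 2]
     else cycle_of_list [1, 2, i+1])"

end

theory Submission
  imports Defs
begin

text \<open>
  View the wreath product as the group of signed permutations of the points \<open>1, -1, \<dots>, n, -n\<close>. After
  renaming each point \<open>j > 1\<close> to \<open>-j\<close>, the elements assigned to \<open>a\<^sub>1\<close>, \<open>a\<^sub>2\<inverse>\<close>, \<open>a\<^sub>i\<close> become
  the signed 3-cycles \<open>(1, 2, 3)\<close>, \<open>(1, 2, -3)\<close>, \<open>(1, 2, i+1)\<close>. All of them share the arc from \<open>1\<close>
  to \<open>2\<close>, and the relations express that any two of them have a product of order 2, except for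
  the pair \<open>a\<^sub>1\<close>, \<open>a\<^sub>2\<inverse>\<close> with opposite third points, where the order-2 element is
  \<open>a\<^sub>1 (a\<^sub>2\<inverse>)\<inverse>\<close>.

  The proof is a comparison of orders around the homomorphisms
  \<open>alt_pres n \<rightarrow> coxeter_D n \<rightarrow> wreath_D n\<close>.

  From above, the relations of the presentation suffice to compute the action on the signed points
  (\<open>orbit_bound\<close>): a coset on which the first \<open>m - 1\<close> generators agree, as they all do on the
  point \<open>2\<close>, has at most \<open>2 * m\<close> translates under them. Along the chain of subgroups generated by the first generators this
  gives the upper bound \<open>2^(n-2) * n!\<close> for the presented group (\<open>alt_pres_order\<close>).

  Next, every group that satisfies the Coxeter relations contains elements that satisfy the
  relations of the presentation (\<open>eval_alt_pres_rels\<close>): \<open>a\<^sub>1 = s\<^sub>0 s\<^sub>2\<close>, its conjugate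
  \<open>a\<^sub>2 = s\<^sub>1 a\<^sub>1 s\<^sub>1\<close>, and \<open>a\<^sub>3 = s\<^sub>3 a\<^sub>1 s\<^sub>3\<close>, \<open>a\<^sub>i = s\<^sub>i a\<^sub>i\<^sub>-\<^sub>1 s\<^sub>i\<close>. Everything reduces by
  conjugation to two computations at the branch of the diagram. These elements generate all even
  words, so the image of the presented group has at most two cosets in the Coxeter group
  (\<open>coxeter_D_cosets\<close>), and the order of the Coxeter group is at most \<open>2^(n-1) * n!\<close>.

  From below, the images of the Coxeter generators generate \<open>wreath_D n\<close>, which has at least
  \<open>2^(n-1) * n!\<close> elements (\<open>wreath_D_generated\<close>). Hence all the inequalities are equalities and
  both homomorphisms are injective. In particular, the Coxeter presentation of \<open>wreath_D n\<close> is a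
  by-product of the bound for the alternating group and needs no coset enumeration of its own.
\<close>

section \<open>Generators and relations\<close>

lemma gword_class_eval:
  assumes "w \<in> gwords S"
  shows "gword_class S R w
    = gword_eval (presented_group S R) (\<lambda>x. gword_class S R (gen x)) w"
  using assms
proof (induction w)
  case Nil
  then show ?case by (simp add: presented_group_def)
next
  case (Cons p w)
  interpret P: group "presented_group S R" by (rule presented_group_is_group)
  obtain x b where p: "p = (x, b)" by force
  have x: "x \<in> S" and w: "w \<in> gwords S" using Cons.prems p by auto
  have "gword_class S R [(x, \<not> True)] = inv\<^bsub>presented_group S R\<^esub> gword_class S R (gen x)"
  proof (rule P.inv_equality[symmetric])
    have "gword_class S R [(x, \<not> True)] \<otimes>\<^bsub>presented_group S R\<^esub> gword_class S R (gen x)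
        = gword_class S R [(x, False), (x, \<not> False)]"
      using x by (simp add: gen_def presented_group_mult)
    also have "\<dots> = gword_class S R []"
      using gword_equiv.cancel[OF x, of R False] x by (subst gword_class_eq_iff) auto
    finally show "gword_class S R [(x, \<not> True)] \<otimes>\<^bsub>presented_group S R\<^esub> gword_class S R (gen x)
        = \<one>\<^bsub>presented_group S R\<^esub>"
      by (simp add: presented_group_def)
  qed (use x in \<open>auto simp: presented_group_def gen_def\<close>)
  moreover have "gword_class S R (p # w)
      = gword_class S R [p] \<otimes>\<^bsub>presented_group S R\<^esub> gword_class S R w"
    using x w p by (simp add: presented_group_mult)
  ultimately show ?case
    using Cons.IH[OF w] by (cases b) (simp_all add: p gen_def)
qed

lemma presented_group_relation:
  assumes "(l, r) \<in> R" "l \<in> gwords S" "r \<in> gwords S"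
  shows "gword_eval (presented_group S R) (\<lambda>x. gword_class S R (gen x)) l
    = gword_eval (presented_group S R) (\<lambda>x. gword_class S R (gen x)) r"
  using assms gword_equiv.rel[OF assms]
  by (simp add: gword_class_eq_iff flip: gword_class_eval)

lemma presented_group_gen_closed:
  "x \<in> S \<Longrightarrow> gword_class S R (gen x) \<in> carrier (presented_group S R)"
  by (auto simp: presented_group_def gen_def)

text \<open>Induction over words, read from left to right.\<close>

lemma presented_group_generated:
  assumes one: "\<one>\<^bsub>presented_group S R\<^esub> \<in> U"
    and gen: "\<And>u x. \<lbrakk>u \<in> U; x \<in> S\<rbrakk> \<Longrightarrow> u \<otimes>\<^bsub>presented_group S R\<^esub> gword_class S R (gen x) \<in> U"
    and inv: "\<And>u x. \<lbrakk>u \<in> U; x \<in> S\<rbrakk>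
      \<Longrightarrow> u \<otimes>\<^bsub>presented_group S R\<^esub> inv\<^bsub>presented_group S R\<^esub> gword_class S R (gen x) \<in> U"
  shows "carrier (presented_group S R) \<subseteq> U"
proof -
  interpret P: group "presented_group S R" by (rule presented_group_is_group)
  have "gword_class S R w \<in> U" if "w \<in> gwords S" for w
    using that
  proof (induction w rule: rev_induct)
    case Nil
    then show ?case using one by (simp add: presented_group_def)
  next
    case (snoc p w)
    obtain x b where p: "p = (x, b)" by force
    have x: "x \<in> S" and w: "w \<in> gwords S" using snoc.prems p by auto
    have "gword_class S R (w @ [p]) = gword_class S R w \<otimes>\<^bsub>presented_group S R\<^esub> gword_class S R [p]"
      using x w p by (simp add: presented_group_mult)
    then show ?case
      using snoc.IH[OF w] x p gen inv gword_class_eval[of "[p]" S R] presented_group_gen_closed[OF x, of R]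
      by (cases b) auto
  qed
  then show ?thesis by (auto simp: presented_group_def)
qed

section \<open>The action on signed points\<close>

text \<open>
  The letters of a word act one after the other on the right cosets of a subgroup; \<open>T i\<close> is the
  action of the \<open>i\<close>-th letter, so that \<open>T j (T i x)\<close> is \<open>x\<close> times the \<open>i\<close>-th times the \<open>j\<close>-th letter.
  The letters \<open>1\<close> and \<open>2\<close> are the two tines of the fork of the Dynkin diagram.
\<close>

locale star_action =
  fixes \<Omega> :: "'p set" and T :: "nat \<Rightarrow> 'p \<Rightarrow> 'p" and m :: nat
  assumes m: "m \<ge> 3"
    and closed: "\<lbrakk>i \<in> {1..<m}; x \<in> \<Omega>\<rbrakk> \<Longrightarrow> T i x \<in> \<Omega>"
    and cube: "\<lbrakk>i \<in> {1..<m}; x \<in> \<Omega>\<rbrakk> \<Longrightarrow> T i (T i (T i x)) = x"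
    and pair: "\<lbrakk>i \<in> {1..<m}; j \<in> {1..<m}; i \<noteq> j; {i, j} \<noteq> {1, 2}; x \<in> \<Omega>\<rbrakk>
      \<Longrightarrow> T i (T j (T i (T j x))) = x"
    and fork: "x \<in> \<Omega> \<Longrightarrow> T 2 (T 2 (T 1 (T 2 (T 2 (T 1 x))))) = x"
begin

lemma cancel: "\<lbrakk>i \<in> {1..<m}; x \<in> \<Omega>; y \<in> \<Omega>; T i x = T i y\<rbrakk> \<Longrightarrow> x = y"
  by (metis cube)

text \<open>
  If \<open>x\<close> is the point \<open>2\<close>, then \<open>T i x\<close> is the point \<open>1\<close> and \<open>T i (T i x)\<close> the third point
  moved by the 3-cycle \<open>i\<close>, which the 3-cycle \<open>j\<close> does not move. The square relation applied at
  \<open>x\<close> forces this.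
\<close>

lemma fixed_point:
  assumes x: "x \<in> \<Omega>" and i: "i \<in> {1..<m}" and j: "j \<in> {1..<m}"
    and "i \<noteq> j" "{i, j} \<noteq> {1, 2}" and eq: "T i x = T j x"
  shows "T j (T i (T i x)) = T i (T i x)"
proof (rule cancel[OF i])
  have "T i (T j (T i (T i x))) = T i (T j (T i (T j x)))"
    using eq by simp
  then show "T i (T j (T i (T i x))) = T i (T i (T i x))"
    using pair[OF i j _ _ x] cube[OF i x] assms(4,5) by simp
qed (use assms closed in auto)

text \<open>
  In the model, \<open>p\<close> is the point \<open>2\<close>, \<open>q\<close> the point \<open>1\<close>, and \<open>u\<close>, \<open>v\<close> are \<open>-2\<close>, \<open>-1\<close>. The remaining
  points \<open>T i q\<close> and \<open>T i v\<close> are \<open>k\<close> and \<open>-k\<close> for the third point \<open>k\<close> of the \<open>i\<close>-th 3-cycle. The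
  two tines have the third points \<open>3\<close> and \<open>-3\<close>, so \<open>T 1 v = T 2 q\<close> and \<open>T 2 v = T 1 q\<close>, and
  together there are \<open>2 * m\<close> points.
\<close>

lemma orbit_bound:
  assumes p: "p \<in> \<Omega>" and pq: "\<And>i. i \<in> {1..<m} \<Longrightarrow> T i p = q"
  shows "\<exists>Orb. p \<in> Orb \<and> Orb \<subseteq> \<Omega> \<and> finite Orb \<and> card Orb \<le> 2 * m
    \<and> (\<forall>i\<in>{1..<m}. T i ` Orb \<subseteq> Orb)"
proof -
  define u v where "u = T 2 (T 1 q)" and "v = T 2 u"
  define Orb where "Orb = {p, q, u, v} \<union> (\<lambda>i. T i q) ` {1..<m} \<union> (\<lambda>i. T i v) ` {3..<m}"
  have i1: "1 \<in> {1..<m}" and i2: "2 \<in> {1..<m}" using m by auto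
  have q: "q \<in> \<Omega>" using closed[OF i1 p] pq[OF i1] by simp
  have u: "u \<in> \<Omega>" and v: "v \<in> \<Omega>" using q closed i1 i2 by (auto simp: u_def v_def)
  have back_q: "T i (T i q) = p" if "i \<in> {1..<m}" for i
    using cube[OF that p] pq[OF that] by simp
  have fix_q: "T j (T i q) = T i q"
    if "i \<in> {1..<m}" "j \<in> {1..<m}" "i \<noteq> j" "{i, j} \<noteq> {1, 2}" for i j
    using fixed_point[OF p that] pq that by simp
  have v2: "T 2 v = T 1 q"
    using cube[OF i2] closed[OF i1 q] by (simp add: u_def v_def)
  \<comment> \<open>In the letters \<open>a\<close>, \<open>b\<close> of the fork, the relation reads \<open>b\<inverse> a = a\<inverse> b\<close> and
    \<open>a b\<inverse> = b a\<inverse>\<close>, with inverses written as squares.\<close>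
  have fork': "T 1 (T 2 (T 2 x)) = T 2 (T 1 (T 1 x))" if "x \<in> \<Omega>" for x
  proof -
    define y where "y = T 1 (T 1 x)"
    have y: "y \<in> \<Omega>" "T 1 y = x" using that closed cube i1 by (auto simp: y_def)
    have "T 2 (T 2 (T 1 (T 2 (T 2 x)))) = T 2 (T 2 (T 2 y))"
      using fork[OF y(1)] y cube[OF i2 y(1)] by simp
    then show ?thesis using cancel[OF i2] closed i1 i2 y that
      by (metis y_def)
  qed
  have fork'': "T 2 (T 2 (T 1 x)) = T 1 (T 1 (T 2 x))" if x: "x \<in> \<Omega>" for x
  proof -
    define z where "z = T 2 (T 2 (T 1 x))"
    have z: "z \<in> \<Omega>" using closed i1 i2 x by (simp add: z_def)
    have "T 2 (T 2 (T 1 z)) = T 2 (T 2 (T 2 x))"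
      using fork[OF x] cube[OF i2 x] by (simp add: z_def)
    then have "T 1 z = T 2 x" using cancel[OF i2] closed i1 i2 z x by metis
    then show ?thesis using cube[OF i1 z] by (simp add: z_def)
  qed
  have v1: "T 1 v = T 2 q"
    using fork'[OF closed[OF i1 q]] cube[OF i1 q] by (simp add: u_def v_def)
  have u1: "T 1 u = v"
  proof -
    have c: "T 1 q \<in> \<Omega>" "T 2 q \<in> \<Omega>" "T 1 (T 2 q) \<in> \<Omega>"
      using q closed i1 i2 by auto
    have "T 1 u = T 1 (T 2 (T 2 (T 2 (T 2 (T 1 q)))))"
      using cube[OF i2 c(1)] by (simp add: u_def)
    also have "\<dots> = T 2 (T 1 (T 1 (T 1 (T 1 (T 2 q)))))"
      using fork'[of "T 2 (T 2 (T 1 q))"] fork''[OF q] c closed i1 i2 by simp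
    also have "\<dots> = T 2 (T 1 (T 2 q))"
      using cube[OF i1 c(2)] by simp
    also have "\<dots> = T 2 (T 2 (T 2 (T 2 (T 1 (T 2 q)))))"
      using cube[OF i2 c(3)] by simp
    also have "\<dots> = T 2 (T 2 (T 1 (T 1 (T 2 (T 2 q)))))"
      using fork''[OF c(2)] by simp
    also have "\<dots> = T 2 (T 2 (T 1 q))"
      using back_q[OF i2] pq[OF i1] by simp
    finally show ?thesis by (simp add: u_def v_def)
  qed
  \<comment> \<open>The point \<open>u\<close> satisfies the hypothesis made on \<open>p\<close>, so the argument for the points
    \<open>T i q\<close> applies again to the points \<open>T i v\<close>.\<close>
  have uv: "T i u = v" if "i \<in> {1..<m}" for i
  proof -
    from that have "1 \<le> i" by simp
    then consider "i = 1" | "i = 2" | "i \<ge> 3" by linarith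
    then show ?thesis
    proof cases
      case 3
      have "T 2 (T i u) = T 2 (T i (T 2 (T i (T 1 q))))"
        using fix_q[OF i1 that] 3 by (auto simp: u_def doubleton_eq_iff)
      also have "\<dots> = T 1 q"
        using pair[OF i2 that] 3 closed[OF i1 q] by (auto simp: doubleton_eq_iff)
      finally show ?thesis using cancel[OF i2] v2 u v closed that by metis
    qed (use u1 v_def in auto)
  qed
  have fix_v: "T j (T i v) = T i v"
    if "i \<in> {1..<m}" "j \<in> {1..<m}" "i \<noteq> j" "{i, j} \<noteq> {1, 2}" for i j
    using fixed_point[OF u that] uv that by simp
  have back_v: "T i (T i v) = u" if "i \<in> {1..<m}" for i
    using cube[OF that u] uv[OF that] by simp
  have q12: "T 1 (T 2 q) = u" using back_v[OF i1] v1 by simp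
  have "T j x \<in> Orb" if j: "j \<in> {1..<m}" and x: "x \<in> Orb" for j x
  proof -
    consider "x = p" | "x = q" | "x = u" | "x = v"
      | i where "x = T i q" "i \<in> {1..<m}" | i where "x = T i v" "i \<in> {3..<m}"
      using x by (auto simp: Orb_def)
    then show ?thesis
    proof cases
      case 4
      from j have "1 \<le> j" "j < m" by simp_all
      then consider "j = 1" | "j = 2" | "3 \<le> j" by linarith
      then show ?thesis using 4 v1 v2 i1 i2 j by cases (auto simp: Orb_def)
    next
      case (5 i)
      consider "i = j" | "i = 1" "j = 2" | "i = 2" "j = 1" | "i \<noteq> j" "{i, j} \<noteq> {1, 2}"
        by (auto simp: doubleton_eq_iff)
      then show ?thesis
        by cases (use 5 j back_q fix_q q12 in \<open>auto simp: Orb_def u_def\<close>)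
    next
      case (6 i)
      then have i: "i \<in> {1..<m}" "{i, j} \<noteq> {1, 2}" by (auto simp: doubleton_eq_iff)
      show ?thesis
      proof (cases "i = j")
        case True
        then show ?thesis using back_v 6 j by (auto simp: Orb_def)
      next
        case False
        then show ?thesis using fix_v[OF i(1) j False i(2)] 6 by (auto simp: Orb_def)
      qed
    qed (use j pq uv in \<open>auto simp: Orb_def\<close>)
  qed
  moreover have "card Orb \<le> 2 * m"
  proof -
    have "card Orb \<le> card {p, q, u, v} + card ((\<lambda>i. T i q) ` {1..<m}) + card ((\<lambda>i. T i v) ` {3..<m})"
      unfolding Orb_def by (meson card_Un_le order.trans add_le_mono order.refl)
    also have "\<dots> \<le> 4 + (m - 1) + (m - 3)"
      by (intro add_le_mono order.trans[OF card_image_le]) (auto simp: card_insert_if)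
    finally show ?thesis using m by simp
  qed
  moreover have "Orb \<subseteq> \<Omega>" using p q u v closed m by (auto simp: Orb_def)
  moreover have "finite Orb" "p \<in> Orb" by (simp_all add: Orb_def)
  ultimately show ?thesis by blast
qed

end

text \<open>
  The presentation with the second generator replaced by its inverse. The relations become
  uniform: every pair of generators except the fork satisfies the same relation.
\<close>

locale star_relations = group G for G (structure) +
  fixes b :: "nat \<Rightarrow> 'a" and N :: nat
  assumes gens: "i \<in> {1..<N} \<Longrightarrow> b i \<in> carrier G"
    and cube: "i \<in> {1..<N} \<Longrightarrow> b i \<otimes> b i \<otimes> b i = \<one>"
    and pair: "\<lbrakk>i \<in> {1..<N}; j \<in> {1..<N}; i < j; (i, j) \<noteq> (1, 2)\<rbrakk>
      \<Longrightarrow> b i \<otimes> b j \<otimes> (b i \<otimes> b j) = \<one>"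
    and fork: "b 1 \<otimes> inv b 2 \<otimes> (b 1 \<otimes> inv b 2) = \<one>"
begin

lemma pair_sym:
  assumes "i \<in> {1..<N}" "j \<in> {1..<N}" "i \<noteq> j" "{i, j} \<noteq> {1, 2}"
  shows "b i \<otimes> b j \<otimes> (b i \<otimes> b j) = \<one>"
proof (cases "i < j")
  case True
  then show ?thesis using assms pair by auto
next
  case False
  then have "b j \<otimes> b i \<otimes> (b j \<otimes> b i) = \<one>"
    using assms pair[of j i] by (auto simp: doubleton_eq_iff)
  then show ?thesis
    using assms gens inv_comm[of "b j" "b i \<otimes> b j \<otimes> b i"] by (simp add: m_assoc)
qed

lemma inv_b: "i \<in> {1..<N} \<Longrightarrow> inv b i = b i \<otimes> b i"
  using cube gens by (intro inv_equality) (auto simp: m_assoc)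

lemma coset_action:
  assumes "3 \<le> m" "m \<le> N"
  shows "star_action (Pow (carrier G)) (\<lambda>i P. P #> b i) m"
proof
  have g: "i \<in> {1..<m} \<Longrightarrow> b i \<in> carrier G" for i using gens assms by auto
  show "3 \<le> m" by fact
  show "P #> b i \<in> Pow (carrier G)" if "i \<in> {1..<m}" "P \<in> Pow (carrier G)" for i P
    using that g r_coset_subset_G by auto
  show "P #> b i #> b i #> b i = P" if "i \<in> {1..<m}" "P \<in> Pow (carrier G)" for i P
    using that g cube[of i] assms by (simp add: coset_mult_assoc m_assoc)
  show "P #> b j #> b i #> b j #> b i = P"
    if "i \<in> {1..<m}" "j \<in> {1..<m}" "i \<noteq> j" "{i, j} \<noteq> {1, 2}" "P \<in> Pow (carrier G)" for i j P
    using that g pair_sym[of j i] assms by (simp add: coset_mult_assoc m_assoc insert_commute)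
  have i12: "1 \<in> {1..<m}" "2 \<in> {1..<N}" "2 \<in> {1..<m}" using assms by auto
  show "P #> b 1 #> b 2 #> b 2 #> b 1 #> b 2 #> b 2 = P" if "P \<in> Pow (carrier G)" for P
    using that g i12 fork[unfolded inv_b[OF i12(2)]]
    by (simp add: coset_mult_assoc m_assoc)
qed

text \<open>
  The hypothesis says that \<open>P\<close> behaves like the point \<open>2\<close>. The union of the translates of \<open>P\<close> is
  stable under the first generators; as soon as it contains the unit element, it contains the
  group generated by them.
\<close>

lemma coset_orbit:
  assumes le: "3 \<le> m" "m \<le> N" and P: "P \<subseteq> carrier G" "finite P"
    and eq: "\<And>i. i \<in> {1..<m} \<Longrightarrow> P #> b i = P'"
  shows "\<exists>U. P \<subseteq> U \<and> U \<subseteq> carrier G \<and> finite U \<and> card U \<le> 2 * m * card P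
    \<and> (\<forall>i\<in>{1..<m}. \<forall>x\<in>U. x \<otimes> b i \<in> U)"
proof -
  interpret star_action "Pow (carrier G)" "\<lambda>i P. P #> b i" m
    by (rule coset_action[OF le])
  from P have "P \<in> Pow (carrier G)" by simp
  from orbit_bound[OF this eq] obtain Orb where Orb: "P \<in> Orb" "Orb \<subseteq> Pow (carrier G)"
    "finite Orb" "card Orb \<le> 2 * m" "\<And>i. i \<in> {1..<m} \<Longrightarrow> (\<lambda>P. P #> b i) ` Orb \<subseteq> Orb"
    by auto
  define U where "U = \<Union> {Q \<in> Orb. finite Q \<and> card Q \<le> card P}"
  have g: "i \<in> {1..<m} \<Longrightarrow> b i \<in> carrier G" for i using gens le by auto
  have "x \<otimes> b i \<in> U" if i: "i \<in> {1..<m}" and x: "x \<in> U" for i x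
  proof -
    obtain Q where Q: "x \<in> Q" "Q \<in> Orb" "finite Q" "card Q \<le> card P"
      using x by (auto simp: U_def)
    have im: "Q #> b i = (\<lambda>y. y \<otimes> b i) ` Q" by (auto simp: r_coset_def)
    have "Q #> b i \<in> Orb" using Orb(5)[OF i] Q(2) by auto
    moreover have "finite (Q #> b i)" "card (Q #> b i) \<le> card P"
      unfolding im using Q card_image_le[OF Q(3), of "\<lambda>y. y \<otimes> b i"] by auto
    ultimately show ?thesis using Q(1) im by (auto simp: U_def)
  qed
  moreover have "card U \<le> 2 * m * card P"
  proof -
    have "card U \<le> (\<Sum>Q | Q \<in> Orb \<and> finite Q \<and> card Q \<le> card P. card Q)"
      unfolding U_def using card_Union_le_sum_card by blast
    also have "\<dots> \<le> card {Q \<in> Orb. finite Q \<and> card Q \<le> card P} * card P"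
      using sum_bounded_above[of "{Q \<in> Orb. finite Q \<and> card Q \<le> card P}" card "card P"] by simp
    also have "\<dots> \<le> 2 * m * card P"
      using card_mono[OF Orb(3), of "{Q \<in> Orb. finite Q \<and> card Q \<le> card P}"] Orb(4)
      by (intro mult_le_mono1) auto
    finally show ?thesis .
  qed
  moreover have "P \<subseteq> U" "U \<subseteq> carrier G" "finite U"
    using Orb P by (auto simp: U_def)
  ultimately show ?thesis by blast
qed

text \<open>
  Coset enumeration along the chain of subgroups generated by the first generators. A set
  \<open>K\<close> that is stable under the generators below \<open>m\<close> plays the role of the stabilizer of the new
  point, and its translate by \<open>b m\<close> that of the coset of the point \<open>2\<close>: by the square relation,
  \<open>K b\<^sub>m b\<^sub>i = K b\<^sub>i\<inverse> b\<^sub>m\<inverse> = K b\<^sub>m\<inverse>\<close> for every \<open>i < m\<close>.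
\<close>

lemma generated_bound:
  assumes "3 \<le> m" "m \<le> N"
  shows "\<exists>K. \<one> \<in> K \<and> K \<subseteq> carrier G \<and> finite K \<and> card K \<le> 2 ^ (m - 2) * fact m
    \<and> (\<forall>i\<in>{1..<m}. \<forall>x\<in>K. x \<otimes> b i \<in> K)"
  using assms
proof (induction m rule: dec_induct)
  case base
  \<comment> \<open>The stabilizer of the point \<open>2\<close> in the alternating group of degree 4 with its action on the six
    points \<open>1\<close>, \<open>-1\<close>, \<open>2\<close>, \<open>-2\<close>, \<open>3\<close>, \<open>-3\<close>.\<close>
  define P where "P = {\<one>, b 1 \<otimes> inv b 2}"
  have b: "b 1 \<in> carrier G" "b 2 \<in> carrier G" using gens base by auto
  have "b 1 \<otimes> inv b 2 = b 2 \<otimes> inv b 1"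
    using inv_equality[OF fork] b by (simp add: inv_mult_group)
  then have "b 1 \<otimes> inv b 2 \<otimes> b 1 = b 2"
    using b by (simp add: m_assoc)
  then have "P #> b i = {b 1, b 2}" if "i \<in> {1..<3}" for i
  proof -
    have "i = 1 \<or> i = 2" using that by auto
    then show ?thesis using b \<open>b 1 \<otimes> inv b 2 \<otimes> b 1 = b 2\<close>
      by (auto simp: P_def r_coset_def m_assoc)
  qed
  from coset_orbit[OF order.refl base(1) _ _ this]
  obtain U where U: "P \<subseteq> U" "U \<subseteq> carrier G" "finite U" "card U \<le> 2 * 3 * card P"
    "\<forall>i\<in>{1..<3}. \<forall>x\<in>U. x \<otimes> b i \<in> U"
    using b by (auto simp: P_def)
  have "card P \<le> 2" by (simp add: P_def card_insert_if)
  with U show ?case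
    by (intro exI[of _ U]) (auto simp: P_def fact_numeral)
next
  case (step m)
  then obtain K where K: "\<one> \<in> K" "K \<subseteq> carrier G" "finite K" "card K \<le> 2 ^ (m - 2) * fact m"
    "\<And>i x. i \<in> {1..<m} \<Longrightarrow> x \<in> K \<Longrightarrow> x \<otimes> b i \<in> K"
    by auto
  have m: "m \<in> {1..<N}" using step by auto
  note bm = gens[OF m]
  have sub: "K #> b i \<subseteq> K" if "i \<in> {1..<m}" for i
    using K(5)[OF that] by (auto simp: r_coset_def)
  have stable: "K #> inv b i = K" if i: "i \<in> {1..<m}" for i
  proof
    have bi: "i \<in> {1..<N}" "b i \<in> carrier G" using i m gens by auto
    have "K #> inv b i = K #> b i #> b i"
      using bi K by (simp add: inv_b coset_mult_assoc)
    also have "\<dots> \<subseteq> K" using K(5)[OF i] by (auto simp: r_coset_def)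
    finally show "K #> inv b i \<subseteq> K" .
    have "K = K #> b i #> inv b i" using bi K by (simp add: coset_mult_assoc)
    also have "\<dots> \<subseteq> K #> inv b i" using sub[OF i] by (auto simp: r_coset_def)
    finally show "K \<subseteq> K #> inv b i" .
  qed
  define P where "P = K #> b m"
  have "P #> b i = K #> inv b m" if i: "i \<in> {1..<Suc m}" for i
  proof (cases "i = m")
    case True
    then show ?thesis using K bm inv_b[OF m] by (simp add: P_def coset_mult_assoc)
  next
    case False
    then have i: "i \<in> {1..<m}" using i by simp
    then have bi: "b i \<in> carrier G" "i \<in> {1..<N}" using m gens by auto
    have "b m \<otimes> b i \<otimes> (b m \<otimes> b i) = \<one>"
      using pair_sym[OF m bi(2)] i step by (auto simp: doubleton_eq_iff)
    then have "b m \<otimes> b i = inv b i \<otimes> inv b m"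
      using inv_equality[of "b m \<otimes> b i" "b m \<otimes> b i"] bm bi by (simp add: inv_mult_group)
    then have "P #> b i = K #> inv b i #> inv b m"
      using K bm bi by (simp add: P_def coset_mult_assoc)
    then show ?thesis using stable[OF i] by simp
  qed
  moreover have "P \<subseteq> carrier G" "finite P"
    using K bm by (auto simp: P_def r_coset_def)
  moreover have "3 \<le> Suc m" "Suc m \<le> N" using step by auto
  ultimately obtain U where U: "P \<subseteq> U" "U \<subseteq> carrier G" "finite U"
    "card U \<le> 2 * Suc m * card P" "\<And>i x. i \<in> {1..<Suc m} \<Longrightarrow> x \<in> U \<Longrightarrow> x \<otimes> b i \<in> U"
    using coset_orbit[of "Suc m" P "K #> inv b m"] by metis
  have "b m \<in> U" using U(1) K(1) bm by (force simp: P_def r_coset_def)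
  then have "b m \<otimes> b m \<otimes> b m \<in> U" using U(5) step by auto
  then have "\<one> \<in> U" using cube[OF m] by simp
  moreover have "card U \<le> 2 ^ (Suc m - 2) * fact (Suc m)"
  proof -
    have "P = (\<lambda>x. x \<otimes> b m) ` K" by (auto simp: P_def r_coset_def)
    then have "card P \<le> 2 ^ (m - 2) * fact m"
      using card_image_le[OF K(3), of "\<lambda>x. x \<otimes> b m"] K(4) by simp
    then have "card U \<le> 2 * Suc m * (2 ^ (m - 2) * fact m)"
      using U(4) by (meson mult_le_mono2 order.trans)
    also have "\<dots> = 2 ^ Suc (m - 2) * fact (Suc m)" by (simp add: algebra_simps)
    also have "Suc (m - 2) = Suc m - 2" using step by simp
    finally show ?thesis .
  qed
  ultimately show ?case using U by blast
qed

end

section \<open>The order of the presented alternating group\<close>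

lemma alt_pres_gen_closed: "i \<in> {1..n-1} \<Longrightarrow> alt_pres_gen n i \<in> carrier (alt_pres n)"
  unfolding alt_pres_def alt_pres_gen_def by (rule presented_group_gen_closed)

lemma alt_pres_generated:
  assumes "\<one>\<^bsub>alt_pres n\<^esub> \<in> U"
    and "\<And>u i. \<lbrakk>u \<in> U; i \<in> {1..n-1}\<rbrakk> \<Longrightarrow> u \<otimes>\<^bsub>alt_pres n\<^esub> alt_pres_gen n i \<in> U"
    and "\<And>u i. \<lbrakk>u \<in> U; i \<in> {1..n-1}\<rbrakk>
      \<Longrightarrow> u \<otimes>\<^bsub>alt_pres n\<^esub> inv\<^bsub>alt_pres n\<^esub> alt_pres_gen n i \<in> U"
  shows "carrier (alt_pres n) \<subseteq> U"
  using assms unfolding alt_pres_def alt_pres_gen_def by (rule presented_group_generated)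

lemma alt_pres_star_relations:
  assumes n: "n \<ge> 3"
  shows "star_relations (alt_pres n)
    (\<lambda>i. if i = 2 then inv\<^bsub>alt_pres n\<^esub> alt_pres_gen n 2 else alt_pres_gen n i) n"
    (is "star_relations ?P ?b n")
proof -
  interpret group ?P
    unfolding alt_pres_def by (rule presented_group_is_group)
  let ?g = "alt_pres_gen n"
  let ?ev = "gword_eval ?P ?g"
  have closed: "?g i \<in> carrier ?P" if "i \<in> {1..<n}" for i
    using that by (intro alt_pres_gen_closed) auto
  have rel: "?ev v = ?ev w"
    if "(v, w) \<in> alt_pres_rels n" "v \<in> gwords {1..n-1}" "w \<in> gwords {1..n-1}" for v w
    using presented_group_relation[OF that]
    by (simp add: alt_pres_def alt_pres_gen_def[abs_def])
  have two: "gpow w 2 = w @ w" and three: "gpow w 3 = w @ w @ w" for w :: "nat gword"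
    by (simp_all add: gpow_def numeral_2_eq_2 numeral_3_eq_3)
  have cube: "?g i \<otimes>\<^bsub>?P\<^esub> ?g i \<otimes>\<^bsub>?P\<^esub> ?g i = \<one>\<^bsub>?P\<^esub>" if i: "i \<in> {1..<n}" for i
  proof -
    have "?ev (gpow (gen i) 3) = ?ev []"
      using i by (intro rel) (auto simp: alt_pres_rels_def three gen_def)
    then show ?thesis using closed[OF i] by (simp add: three gen_def m_assoc)
  qed
  have pair1: "?g 1 \<otimes>\<^bsub>?P\<^esub> ?g i \<otimes>\<^bsub>?P\<^esub> (?g 1 \<otimes>\<^bsub>?P\<^esub> ?g i) = \<one>\<^bsub>?P\<^esub>" if i: "i \<in> {2..<n}" for i
  proof -
    have "?ev (gpow (gen 1 @ gen i) 2) = ?ev []"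
      using i by (intro rel) (auto simp: alt_pres_rels_def two gen_def)
    then show ?thesis using closed[of 1] closed[of i] i by (simp add: two gen_def m_assoc)
  qed
  have i2: "2 \<in> {1..<n}" using n by simp
  have inv2: "inv\<^bsub>?P\<^esub> ?g 2 = ?g 2 \<otimes>\<^bsub>?P\<^esub> ?g 2"
    using cube[OF i2] closed[OF i2] by (intro inv_equality) (auto simp: m_assoc)
  have pair2: "inv\<^bsub>?P\<^esub> ?g 2 \<otimes>\<^bsub>?P\<^esub> ?g i \<otimes>\<^bsub>?P\<^esub> (inv\<^bsub>?P\<^esub> ?g 2 \<otimes>\<^bsub>?P\<^esub> ?g i) = \<one>\<^bsub>?P\<^esub>"
    if i: "i \<in> {3..<n}" for i
  proof -
    have "?ev (gpow (gpow (gen 2) 2 @ gen i) 2) = ?ev []"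
      using i by (intro rel) (auto simp: alt_pres_rels_def two gen_def)
    then show ?thesis using closed[OF i2] closed[of i] i by (simp add: two gen_def m_assoc inv2)
  qed
  have pair3: "?g i \<otimes>\<^bsub>?P\<^esub> ?g j \<otimes>\<^bsub>?P\<^esub> (?g i \<otimes>\<^bsub>?P\<^esub> ?g j) = \<one>\<^bsub>?P\<^esub>"
    if ij: "i \<in> {3..<n}" "j \<in> {3..<n}" "i < j" for i j
  proof -
    have "?ev (gpow (gen i @ gen j) 2) = ?ev []"
      using ij by (intro rel) (auto simp: alt_pres_rels_def two gen_def)
    then show ?thesis using closed[of i] closed[of j] ij by (simp add: two gen_def m_assoc)
  qed
  have inv_cube: "inv\<^bsub>?P\<^esub> ?g 2 \<otimes>\<^bsub>?P\<^esub> inv\<^bsub>?P\<^esub> ?g 2 \<otimes>\<^bsub>?P\<^esub> inv\<^bsub>?P\<^esub> ?g 2 = \<one>\<^bsub>?P\<^esub>"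
    using arg_cong[OF cube[OF i2], of "m_inv ?P"] closed[OF i2]
    by (simp add: inv_mult_group m_assoc)
  show ?thesis
  proof
    fix i assume i: "i \<in> {1..<n}"
    show "?b i \<in> carrier ?P"
      using closed[OF i] closed[OF i2] by simp
    show "?b i \<otimes>\<^bsub>?P\<^esub> ?b i \<otimes>\<^bsub>?P\<^esub> ?b i = \<one>\<^bsub>?P\<^esub>"
      using cube[OF i] inv_cube by simp
    fix j assume "j \<in> {1..<n}" "i < j" "(i, j) \<noteq> (1, 2)"
    then consider "i = 1" "j \<in> {3..<n}" | "i = 2" "j \<in> {3..<n}" | "i \<in> {3..<n}" "j \<in> {3..<n}"
      using i by fastforce
    then show "?b i \<otimes>\<^bsub>?P\<^esub> ?b j \<otimes>\<^bsub>?P\<^esub> (?b i \<otimes>\<^bsub>?P\<^esub> ?b j) = \<one>\<^bsub>?P\<^esub>"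
      by cases (use pair1[of j] pair2[of j] pair3[of i j] \<open>i < j\<close> in auto)
  next
    show "?b 1 \<otimes>\<^bsub>?P\<^esub> inv\<^bsub>?P\<^esub> ?b 2 \<otimes>\<^bsub>?P\<^esub> (?b 1 \<otimes>\<^bsub>?P\<^esub> inv\<^bsub>?P\<^esub> ?b 2) = \<one>\<^bsub>?P\<^esub>"
      using pair1[of 2] closed[OF i2] n by simp
  qed
qed

lemma alt_pres_order:
  assumes n: "n \<ge> 3"
  shows "finite (carrier (alt_pres n))" "card (carrier (alt_pres n)) \<le> 2 ^ (n - 2) * fact n"
proof -
  define b where "b i = (if i = 2 then inv\<^bsub>alt_pres n\<^esub> alt_pres_gen n 2 else alt_pres_gen n i)" for i
  interpret star_relations "alt_pres n" b n
    unfolding b_def by (rule alt_pres_star_relations[OF n])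
  obtain K where K: "\<one>\<^bsub>alt_pres n\<^esub> \<in> K" "K \<subseteq> carrier (alt_pres n)" "finite K"
    "card K \<le> 2 ^ (n - 2) * fact n" "\<And>i x. i \<in> {1..<n} \<Longrightarrow> x \<in> K \<Longrightarrow> x \<otimes>\<^bsub>alt_pres n\<^esub> b i \<in> K"
    using generated_bound[OF n order.refl] by auto
  have inv_b_K: "x \<otimes>\<^bsub>alt_pres n\<^esub> inv\<^bsub>alt_pres n\<^esub> b i \<in> K" if "i \<in> {1..<n}" "x \<in> K" for i x
    using K(5)[OF that(1) K(5)[OF that]] K(2) gens[OF that(1)] that
    by (auto simp: inv_b m_assoc subset_iff)
  have gen_inv_K: "x \<otimes>\<^bsub>alt_pres n\<^esub> alt_pres_gen n i \<in> K
      \<and> x \<otimes>\<^bsub>alt_pres n\<^esub> inv\<^bsub>alt_pres n\<^esub> alt_pres_gen n i \<in> K" if i: "i \<in> {1..n-1}" and x: "x \<in> K" for i x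
  proof -
    have i': "i \<in> {1..<n}" using i n by auto
    show ?thesis
      using K(5)[OF i' x] inv_b_K[OF i' x] alt_pres_gen_closed[OF i]
      by (cases "i = 2") (auto simp: b_def)
  qed
  have "carrier (alt_pres n) \<subseteq> K"
    by (rule alt_pres_generated) (use K(1) gen_inv_K in simp_all)
  then show "finite (carrier (alt_pres n))" "card (carrier (alt_pres n)) \<le> 2 ^ (n - 2) * fact n"
    using K card_mono[OF K(3)] by (auto intro: finite_subset)
qed

section \<open>The alternating relations in the Coxeter group\<close>

context group
begin

lemma conj_mult:
  assumes "x \<in> carrier G" "y \<in> carrier G" "z \<in> carrier G" "x \<otimes> x = \<one>"
  shows "x \<otimes> y \<otimes> x \<otimes> (x \<otimes> z \<otimes> x) = x \<otimes> (y \<otimes> z) \<otimes> x"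
proof -
  have "x \<otimes> y \<otimes> x \<otimes> (x \<otimes> z \<otimes> x) = x \<otimes> y \<otimes> (x \<otimes> x) \<otimes> (z \<otimes> x)"
    using assms(1-3) by (simp add: m_assoc)
  then show ?thesis using assms by (simp add: m_assoc)
qed

lemma conj_square:
  assumes "x \<in> carrier G" "y \<in> carrier G" "x \<otimes> x = \<one>" "y \<otimes> y = \<one>"
  shows "x \<otimes> y \<otimes> x \<otimes> (x \<otimes> y \<otimes> x) = \<one>"
  using assms by (simp add: conj_mult)

lemma conj_cube:
  assumes "x \<in> carrier G" "y \<in> carrier G" "x \<otimes> x = \<one>" "y \<otimes> y \<otimes> y = \<one>"
  shows "x \<otimes> y \<otimes> x \<otimes> (x \<otimes> y \<otimes> x) \<otimes> (x \<otimes> y \<otimes> x) = \<one>"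
  using assms by (simp add: conj_mult)

lemma conj_commuting:
  assumes "x \<in> carrier G" "y \<in> carrier G" "x \<otimes> x = \<one>" "x \<otimes> y = y \<otimes> x"
  shows "x \<otimes> y \<otimes> x = y"
  using assms by (simp add: m_assoc)

lemma left_cancel_involution:
  assumes "x \<in> carrier G" "y \<in> carrier G" "x \<otimes> x = \<one>"
  shows "x \<otimes> (x \<otimes> y) = y"
  using assms by (simp flip: m_assoc)

lemma commute_mult:
  assumes "x \<in> carrier G" "y \<in> carrier G" "z \<in> carrier G" "x \<otimes> y = y \<otimes> x" "x \<otimes> z = z \<otimes> x"
  shows "x \<otimes> (y \<otimes> z) = y \<otimes> z \<otimes> x"
  using assms by (metis m_assoc)

text \<open>
  If \<open>x\<close>, \<open>y\<close>, \<open>z\<close> are consecutive simple reflections, then the reflection \<open>y x y\<close> takes the place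
  of \<open>y\<close> in a braid relation with \<open>z\<close>.
\<close>

lemma braid_conj:
  assumes xyz: "x \<in> carrier G" "y \<in> carrier G" "z \<in> carrier G"
    and inv: "x \<otimes> x = \<one>" "y \<otimes> y = \<one>" "z \<otimes> z = \<one>"
    and xy: "x \<otimes> y \<otimes> x = y \<otimes> x \<otimes> y" and yz: "y \<otimes> z \<otimes> y = z \<otimes> y \<otimes> z"
    and xz: "x \<otimes> z = z \<otimes> x"
  defines "w \<equiv> y \<otimes> x \<otimes> y"
  shows "w \<otimes> z \<otimes> w = z \<otimes> w \<otimes> z"
proof -
  have w: "w \<in> carrier G" using xyz by (simp add: w_def)
  have "w \<otimes> z \<otimes> w = x \<otimes> y \<otimes> x \<otimes> z \<otimes> (x \<otimes> y \<otimes> x)"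
    by (simp add: w_def xy)
  also have "\<dots> = x \<otimes> y \<otimes> (x \<otimes> z \<otimes> x) \<otimes> (y \<otimes> x)"
    using xyz by (simp add: m_assoc)
  also have "\<dots> = x \<otimes> (y \<otimes> z \<otimes> y) \<otimes> x"
    using xyz inv xz by (simp add: conj_commuting m_assoc)
  also have "\<dots> = (x \<otimes> z) \<otimes> y \<otimes> (z \<otimes> x)"
    using xyz by (simp add: yz m_assoc)
  also have "\<dots> = z \<otimes> (x \<otimes> y \<otimes> x) \<otimes> z"
    using xyz by (simp add: xz[symmetric] m_assoc) (simp add: xz m_assoc[symmetric])
  finally show ?thesis by (simp add: w_def xy)
qed

text \<open>
  The source of the square relations that do not involve \<open>a\<^sub>2\<^sup>2\<close>: for a branch \<open>y\<close> with commuting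
  neighbours \<open>x\<close> and \<open>z\<close>, the product of the rotation \<open>x y\<close> with its conjugate under \<open>z\<close> is
  conjugate to the involution \<open>x z\<close>.
\<close>

lemma fork_square:
  assumes xyz: "x \<in> carrier G" "y \<in> carrier G" "z \<in> carrier G"
    and inv: "x \<otimes> x = \<one>" "y \<otimes> y = \<one>" "z \<otimes> z = \<one>"
    and xy: "x \<otimes> y \<otimes> x = y \<otimes> x \<otimes> y" and yz: "z \<otimes> y \<otimes> z = y \<otimes> z \<otimes> y"
    and xz: "x \<otimes> z = z \<otimes> x"
  shows "x \<otimes> y \<otimes> (z \<otimes> (x \<otimes> y) \<otimes> z) = y \<otimes> (x \<otimes> z) \<otimes> y"
    and "y \<otimes> (x \<otimes> z) \<otimes> y \<otimes> (y \<otimes> (x \<otimes> z) \<otimes> y) = \<one>"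
proof -
  have "x \<otimes> y \<otimes> (z \<otimes> (x \<otimes> y) \<otimes> z) = x \<otimes> y \<otimes> (z \<otimes> x) \<otimes> y \<otimes> z"
    using xyz by (simp add: m_assoc)
  also have "\<dots> = (x \<otimes> y \<otimes> x) \<otimes> (z \<otimes> y \<otimes> z)"
    using xyz by (simp add: xz[symmetric] m_assoc)
  also have "\<dots> = y \<otimes> x \<otimes> (y \<otimes> y) \<otimes> z \<otimes> y"
    unfolding xy yz using xyz by (simp add: m_assoc)
  also have "\<dots> = y \<otimes> (x \<otimes> z) \<otimes> y"
    using xyz inv by (simp add: m_assoc)
  finally show "x \<otimes> y \<otimes> (z \<otimes> (x \<otimes> y) \<otimes> z) = y \<otimes> (x \<otimes> z) \<otimes> y" .
  have "x \<otimes> z \<otimes> (x \<otimes> z) = x \<otimes> x \<otimes> (z \<otimes> z)"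
    using xyz xz by (metis m_assoc m_closed)
  then show "y \<otimes> (x \<otimes> z) \<otimes> y \<otimes> (y \<otimes> (x \<otimes> z) \<otimes> y) = \<one>"
    using xyz inv by (intro conj_square) auto
qed

end

locale coxeter_D_relations = group G for G (structure) +
  fixes s :: "nat \<Rightarrow> 'a" and n :: nat
  assumes n: "n \<ge> 3"
    and s_closed: "i < n \<Longrightarrow> s i \<in> carrier G"
    and s_square: "i < n \<Longrightarrow> s i \<otimes> s i = \<one>"
    and s02: "s 0 \<otimes> s 2 \<otimes> s 0 = s 2 \<otimes> s 0 \<otimes> s 2"
    and braid: "\<lbrakk>1 \<le> i; i + 1 < n\<rbrakk> \<Longrightarrow> s i \<otimes> s (i+1) \<otimes> s i = s (i+1) \<otimes> s i \<otimes> s (i+1)"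
    and s01: "s 0 \<otimes> s 1 = s 1 \<otimes> s 0"
    and s0i: "\<lbrakk>3 \<le> i; i < n\<rbrakk> \<Longrightarrow> s 0 \<otimes> s i = s i \<otimes> s 0"
    and far: "\<lbrakk>1 \<le> i; i + 1 < j; j < n\<rbrakk> \<Longrightarrow> s i \<otimes> s j = s j \<otimes> s i"
begin

text \<open>
  In the wreath product, \<open>r k\<close> is the transposition of \<open>2\<close> and \<open>k + 3\<close>, the rotation \<open>d k\<close> is the
  image of the generator of index \<open>k + 2\<close> (for \<open>k > 0\<close>) or \<open>1\<close> (for \<open>k = 0\<close>), and \<open>e\<close> is
  the image of the generator of index \<open>2\<close>.
\<close>

primrec r :: "nat \<Rightarrow> 'a"
  where
    "r 0 = s 2"
  | "r (Suc k) = s (k + 3) \<otimes> r k \<otimes> s (k + 3)"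

definition d :: "nat \<Rightarrow> 'a" where "d k = s 0 \<otimes> r k"

definition e :: 'a where "e = s 1 \<otimes> (s 0 \<otimes> s 2) \<otimes> s 1"

lemma s012 [unfolded One_nat_def]: "s 0 \<in> carrier G" "s 1 \<in> carrier G" "s 2 \<in> carrier G"
  "s 0 \<otimes> s 0 = \<one>" "s 1 \<otimes> s 1 = \<one>" "s 2 \<otimes> s 2 = \<one>"
  using s_closed s_square n by auto

lemma s12: "s 1 \<otimes> s 2 \<otimes> s 1 = s 2 \<otimes> s 1 \<otimes> s 2"
  using braid[of 1] n by (simp add: numeral_2_eq_2)

lemma r_closed: "k + 2 < n \<Longrightarrow> r k \<in> carrier G"
  by (induction k) (auto simp: s012 s_closed)

lemma r_square: "k + 2 < n \<Longrightarrow> r k \<otimes> r k = \<one>"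
proof (induction k)
  case (Suc k)
  then show ?case
    using conj_square[of "s (k + 3)" "r k"] s_closed[of "k + 3"] s_square[of "k + 3"] r_closed
    by simp
qed (simp add: s012)

lemma d_closed: "k + 2 < n \<Longrightarrow> d k \<in> carrier G"
  by (simp add: d_def r_closed s012)

lemma e_closed: "e \<in> carrier G"
  by (simp add: e_def s012)

lemma r_far: "\<lbrakk>k + 4 \<le> j; j < n\<rbrakk> \<Longrightarrow> s j \<otimes> r k = r k \<otimes> s j"
proof (induction k)
  case 0
  then show ?case using far[of 2 j] by simp
next
  case (Suc k)
  then show ?case
    using far[of "k + 3" j] by (simp add: commute_mult s_closed r_closed)
qed

lemma r_braid: "k + 3 < n \<Longrightarrow> r k \<otimes> s (k + 3) \<otimes> r k = s (k + 3) \<otimes> r k \<otimes> s (k + 3)"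
proof (induction k)
  case 0
  then show ?case using braid[of 2] by (simp add: numeral_3_eq_3)
next
  case (Suc k)
  have "k + 4 = (k + 3) + 1" by simp
  then show ?case
    using Suc braid_conj[of "r k" "s (k + 3)" "s (k + 4)"] braid[of "k + 3"] r_far[of k "k + 4"]
    by (simp add: s_closed r_closed s_square r_square add.commute[of _ k] numeral_eq_Suc)
qed

text \<open>\<open>s (i + 3)\<close> permutes two points strictly between \<open>2\<close> and \<open>k + 5\<close>.\<close>

lemma s_r_near: "\<lbrakk>i \<le> k; k + 4 < n\<rbrakk> \<Longrightarrow> s (i + 3) \<otimes> r (k + 2) = r (k + 2) \<otimes> s (i + 3)"
proof (induction k rule: dec_induct)
  case base
  define a c where "a = s (i + 3)" and "c = s (i + 4)"
  have ac: "a \<in> carrier G" "c \<in> carrier G" "r i \<in> carrier G"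
    using base by (simp_all add: a_def c_def s_closed r_closed)
  have aca: "a \<otimes> c \<otimes> a = c \<otimes> a \<otimes> c"
    using braid[of "i + 3"] base by (simp add: a_def c_def numeral_eq_Suc)
  have cr: "c \<otimes> r i = r i \<otimes> c"
    using r_far[of i "i + 4"] base by (simp add: c_def)
  define w where "w = r (i + 2)"
  have r2: "w = c \<otimes> a \<otimes> r i \<otimes> a \<otimes> c"
    using ac by (simp add: w_def a_def c_def m_assoc add.commute[of _ i])
  have "a \<otimes> w = (a \<otimes> c \<otimes> a) \<otimes> r i \<otimes> a \<otimes> c"
    using ac by (simp add: r2 m_assoc)
  also have "\<dots> = c \<otimes> a \<otimes> (c \<otimes> r i) \<otimes> a \<otimes> c"
    using ac by (simp add: aca m_assoc)
  also have "\<dots> = c \<otimes> a \<otimes> r i \<otimes> (c \<otimes> a \<otimes> c)"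
    using ac by (simp add: cr m_assoc)
  also have "\<dots> = c \<otimes> a \<otimes> r i \<otimes> (a \<otimes> c \<otimes> a)"
    by (simp add: aca)
  also have "\<dots> = w \<otimes> a"
    using ac by (simp add: r2 m_assoc)
  finally show ?case by (simp add: a_def w_def)
next
  case (step k)
  have "s (i + 3) \<otimes> s (k + 5) = s (k + 5) \<otimes> s (i + 3)"
    using far[of "i + 3" "k + 5"] step by simp
  moreover have "r (Suc k + 2) = s (k + 5) \<otimes> r (k + 2) \<otimes> s (k + 5)"
    by (simp add: add.commute[of _ k])
  moreover have "s (i + 3) \<in> carrier G" "s (k + 5) \<in> carrier G" "r (k + 2) \<in> carrier G"
    using step by (simp_all add: s_closed r_closed)
  ultimately show ?case
    using step.IH step.prems by (simp only: commute_mult m_closed)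
qed

lemma d_Suc: "k + 3 < n \<Longrightarrow> d (Suc k) = s (k + 3) \<otimes> d k \<otimes> s (k + 3)"
  using s0i[of "k + 3"] by (simp add: d_def s012 s_closed r_closed flip: m_assoc)

lemma s_d_commute:
  assumes "3 \<le> j" "j < n" "k + 2 < n" "s j \<otimes> r k = r k \<otimes> s j"
  shows "s j \<otimes> d k = d k \<otimes> s j"
  using assms s0i[of j] by (simp add: d_def commute_mult s012 s_closed r_closed)

lemma d_cube: "k + 2 < n \<Longrightarrow> d k \<otimes> d k \<otimes> d k = \<one>"
proof (induction k)
  case 0
  have "d 0 \<otimes> d 0 \<otimes> d 0 = (s 0 \<otimes> s 2 \<otimes> s 0) \<otimes> (s 2 \<otimes> s 0 \<otimes> s 2)"
    by (simp add: d_def s012 m_assoc)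
  also have "\<dots> = (s 2 \<otimes> s 0 \<otimes> s 2) \<otimes> (s 2 \<otimes> s 0 \<otimes> s 2)"
    by (simp only: s02)
  also have "\<dots> = \<one>" by (rule conj_square) (simp_all add: s012)
  finally show ?case .
next
  case (Suc k)
  then show ?case
    using conj_cube[of "s (k + 3)" "d k"] d_closed s_closed[of "k + 3"] s_square[of "k + 3"]
    by (simp add: d_Suc)
qed

lemma e_cube: "e \<otimes> e \<otimes> e = \<one>"
  using d_cube[of 0] n unfolding e_def d_def by (intro conj_cube) (simp_all add: s012)

lemma d0_e: "d 0 \<otimes> e \<otimes> (d 0 \<otimes> e) = \<one>"
  unfolding d_def e_def r.simps
  using fork_square[of "s 0" "s 2" "s 1"] s012 s02 s12 s01 by simp

text \<open>
  Conjugation by a simple reflection that commutes with one of the two factors lowers an index,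
  until the pair sits at the branch. The descent ends in \<open>fork_square\<close> here and in \<open>d_pair\<close>, and in
  \<open>inv_e_d1\<close> for \<open>e_pair\<close>.
\<close>

lemma d_pair0: "\<lbrakk>0 < j; j + 2 < n\<rbrakk> \<Longrightarrow> d 0 \<otimes> d j \<otimes> (d 0 \<otimes> d j) = \<one>"
proof (induction j)
  case (Suc j)
  have s3: "s (j + 3) \<in> carrier G" "s (j + 3) \<otimes> s (j + 3) = \<one>"
    using Suc by (simp_all add: s_closed s_square)
  show ?case
  proof (cases "j = 0")
    case True
    have "d 0 \<otimes> d 1 = s 0 \<otimes> s 2 \<otimes> (s 3 \<otimes> (s 0 \<otimes> s 2) \<otimes> s 3)"
      using d_Suc[of 0] Suc True by (simp add: d_def)
    then show ?thesis
      using fork_square[of "s 0" "s 2" "s 3"] s012 s02 s0i[of 3] braid[of 2] Suc True s3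
      by simp
  next
    case False
    have "s (j + 3) \<otimes> d 0 = d 0 \<otimes> s (j + 3)"
      using s_d_commute[of "j + 3" 0] r_far[of 0 "j + 3"] Suc False by simp
    then have "d 0 = s (j + 3) \<otimes> d 0 \<otimes> s (j + 3)"
      using s3 d_closed[of 0] n by (intro conj_commuting[symmetric]) auto
    then have "d 0 \<otimes> d (Suc j) = s (j + 3) \<otimes> (d 0 \<otimes> d j) \<otimes> s (j + 3)"
      using conj_mult[of "s (j + 3)" "d 0" "d j"] d_Suc[of j] s3 d_closed Suc by simp
    then show ?thesis
      using conj_square[of "s (j + 3)" "d 0 \<otimes> d j"] s3 d_closed Suc False by simp
  qed
qed simp

lemma d_pair: "\<lbrakk>i < j; j + 2 < n\<rbrakk> \<Longrightarrow> d i \<otimes> d j \<otimes> (d i \<otimes> d j) = \<one>"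
proof (induction i)
  case 0
  then show ?case using d_pair0 by simp
next
  case (Suc i)
  have s3: "s (i + 3) \<in> carrier G" "s (i + 3) \<otimes> s (i + 3) = \<one>"
    using Suc by (simp_all add: s_closed s_square)
  obtain k where k: "j = k + 2" "i \<le> k"
    using Suc.prems less_iff_Suc_add[of "Suc i" j] by auto
  have "s (i + 3) \<otimes> d j = d j \<otimes> s (i + 3)"
    using s_d_commute[of "i + 3" j] s_r_near[of i k] Suc k by simp
  then have "d j = s (i + 3) \<otimes> d j \<otimes> s (i + 3)"
    using s3 d_closed[of j] Suc by (intro conj_commuting[symmetric]) auto
  then have "d (Suc i) \<otimes> d j = s (i + 3) \<otimes> (d i \<otimes> d j) \<otimes> s (i + 3)"
    using conj_mult[of "s (i + 3)" "d i" "d j"] d_Suc[of i] s3 d_closed Suc by simp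
  then show ?case
    using conj_square[of "s (i + 3)" "d i \<otimes> d j"] s3 d_closed Suc by simp
qed

lemma inv_e: "inv e = s 1 \<otimes> (s 2 \<otimes> s 0) \<otimes> s 1"
  by (rule inv_equality) (simp_all add: e_def s012 m_assoc left_cancel_involution)

lemma inv_e_d1:
  assumes "3 < n"
  shows "inv e \<otimes> d 1 = s 2 \<otimes> (s 1 \<otimes> s 3) \<otimes> s 2"
proof -
  note c = s012 s_closed[OF assms]
  have "inv e \<otimes> d 1 = s 1 \<otimes> s 2 \<otimes> ((s 0 \<otimes> s 1) \<otimes> s 0) \<otimes> (s 3 \<otimes> s 2 \<otimes> s 3)"
    using c by (simp add: inv_e d_def m_assoc)
  also have "\<dots> = (s 1 \<otimes> s 2 \<otimes> s 1) \<otimes> (s 3 \<otimes> s 2 \<otimes> s 3)"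
    using c conj_commuting[of "s 0" "s 1"] s01 by (simp add: m_assoc)
  also have "\<dots> = (s 2 \<otimes> s 1 \<otimes> s 2) \<otimes> (s 2 \<otimes> s 3 \<otimes> s 2)"
    using s12 braid[of 2] assms by simp
  also have "\<dots> = s 2 \<otimes> (s 1 \<otimes> s 3) \<otimes> s 2"
    using c by (simp add: m_assoc left_cancel_involution)
  finally show ?thesis .
qed

lemma e_pair: "\<lbrakk>0 < k; k + 2 < n\<rbrakk> \<Longrightarrow> inv e \<otimes> d k \<otimes> (inv e \<otimes> d k) = \<one>"
proof (induction k)
  case (Suc k)
  define a where "a = s (k + 3)"
  have a: "a \<in> carrier G" "a \<otimes> a = \<one>"
    using Suc by (simp_all add: a_def s_closed s_square)
  show ?case
  proof (cases "k = 0")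
    case True
    have "s 1 \<otimes> s 3 \<otimes> (s 1 \<otimes> s 3) = s 1 \<otimes> (s 3 \<otimes> s 1) \<otimes> s 3"
      using a s012 True by (simp add: a_def m_assoc)
    also have "\<dots> = \<one>"
      using a s012 True far[of 1 3] Suc by (simp add: a_def m_assoc left_cancel_involution)
    finally show ?thesis
      using conj_square[of "s 2" "s 1 \<otimes> s 3"] inv_e_d1 a s012 True Suc by (simp add: a_def)
  next
    case False
    have "a \<otimes> s 0 = s 0 \<otimes> a" "a \<otimes> s 1 = s 1 \<otimes> a" "a \<otimes> s 2 = s 2 \<otimes> a"
      using s0i[of "k + 3"] far[of 1 "k + 3"] far[of 2 "k + 3"] False Suc by (simp_all add: a_def)
    then have "a \<otimes> inv e = inv e \<otimes> a"
      unfolding inv_e using a s012 by (intro commute_mult) auto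
    then have "inv e = a \<otimes> inv e \<otimes> a"
      using a e_closed by (intro conj_commuting[symmetric]) auto
    then have "inv e \<otimes> d (Suc k) = a \<otimes> (inv e \<otimes> d k) \<otimes> a"
      using conj_mult[of a "inv e" "d k"] d_Suc[of k] a d_closed e_closed Suc
      by (simp add: a_def)
    then show ?thesis
      using conj_square[of a "inv e \<otimes> d k"] a d_closed e_closed Suc False by simp
  qed
qed simp

lemma s01_eq: "s 0 \<otimes> s 1 = d 0 \<otimes> inv e \<otimes> d 0"
proof -
  have "d 0 \<otimes> inv e \<otimes> d 0 = s 0 \<otimes> s 2 \<otimes> s 1 \<otimes> s 2 \<otimes> (s 0 \<otimes> s 1 \<otimes> s 0) \<otimes> s 2"
    using s012 by (simp add: d_def inv_e m_assoc)
  also have "\<dots> = s 0 \<otimes> s 2 \<otimes> (s 1 \<otimes> s 2 \<otimes> s 1) \<otimes> s 2"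
    using s012 conj_commuting[of "s 0" "s 1"] s01 by (simp add: m_assoc)
  also have "\<dots> = s 0 \<otimes> s 1"
    unfolding s12 using s012 by (simp add: m_assoc left_cancel_involution)
  finally show ?thesis by simp
qed

lemma s0i_eq:
  assumes "k + 3 < n"
  shows "s 0 \<otimes> s (k + 3) = d (Suc k) \<otimes> inv (d k) \<otimes> d (Suc k)"
proof -
  have c: "s 0 \<in> carrier G" "s 0 \<otimes> s 0 = \<one>" "r k \<in> carrier G" "r k \<otimes> r k = \<one>"
    "s (k + 3) \<in> carrier G"
    using assms by (simp_all add: s012 r_closed r_square s_closed)
  have r': "r (Suc k) = r k \<otimes> s (k + 3) \<otimes> r k" using r_braid[OF assms] by simp
  have "inv (d k) = r k \<otimes> s 0"
    using c by (intro inv_equality) (simp_all add: d_def m_assoc left_cancel_involution)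
  then have "d (Suc k) \<otimes> inv (d k) \<otimes> d (Suc k)
      = s 0 \<otimes> r k \<otimes> (s (k + 3) \<otimes> r k \<otimes> s (k + 3)) \<otimes> r k"
    unfolding d_def r' using c by (simp add: m_assoc left_cancel_involution)
  also have "\<dots> = s 0 \<otimes> s (k + 3)"
    unfolding r_braid[OF assms, symmetric] using c by (simp add: m_assoc left_cancel_involution)
  finally show ?thesis by simp
qed

text \<open>
  A subgroup with these elements contains all products of two simple reflections, because
  \<open>s\<^sub>i s\<^sub>j = (s\<^sub>0 s\<^sub>i)\<inverse> (s\<^sub>0 s\<^sub>j)\<close>.
\<close>

lemma even_words:
  assumes A: "subgroup A G" and d: "\<And>k. k + 2 < n \<Longrightarrow> d k \<in> A" and e: "e \<in> A" and i: "i < n"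
  shows "s 0 \<otimes> s i \<in> A"
proof -
  consider "i = 0" | "i = 1" | "i = 2" | "i = (i - 3) + 3"
    by linarith
  then show ?thesis
  proof cases
    case 1
    then show ?thesis using s012 subgroup.one_closed[OF A] by simp
  next
    case 2
    then show ?thesis
      unfolding 2 s01_eq using A d[of 0] e n
      by (intro subgroup.m_closed[OF A] subgroup.m_inv_closed[OF A]) auto
  next
    case 3
    then show ?thesis using d[of 0] n by (simp add: d_def)
  next
    case 4
    then obtain k where k: "i = k + 3" by blast
    then show ?thesis
      using s0i_eq[of k] d[of k] d[of "Suc k"] i
      by (simp add: subgroup.m_closed[OF A] subgroup.m_inv_closed[OF A])
  qed
qed

end

context coxeter_D_relations
begin

lemma eval_coxeter_D_rels:
  assumes "(v, w) \<in> coxeter_D_rels n"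
  shows "gword_eval G s v = gword_eval G s w"
proof -
  have far': "s i \<otimes> s j = s j \<otimes> s i"
    if "i \<in> {1..n-1}" "j \<in> {1..n-1}" "\<bar>int i - int j\<bar> > 1" for i j
  proof (cases "i < j")
    case True
    then show ?thesis using far[of i j] that by auto
  next
    case False
    then show ?thesis using far[of j i] that by auto
  qed
  have less: "i < n" if "i \<in> {k..n-1}" for i k
    using that n by auto
  from assms consider i where "i \<in> {0..n-1}" "v = gpow (gen i) 2" "w = []"
    | "v = gen 0 @ gen 2 @ gen 0" "w = gen 2 @ gen 0 @ gen 2"
    | i where "i \<in> {1..n-2}" "v = gen i @ gen (i+1) @ gen i" "w = gen (i+1) @ gen i @ gen (i+1)"
    | "v = gen 0 @ gen 1" "w = gen 1 @ gen 0"
    | i where "i \<in> {3..n-1}" "v = gen 0 @ gen i" "w = gen i @ gen 0"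
    | i j where "i \<in> {1..n-1}" "j \<in> {1..n-1}" "\<bar>int i - int j\<bar> > 1"
      "v = gen i @ gen j" "w = gen j @ gen i"
    unfolding coxeter_D_rels_def by blast
  then show ?thesis
  proof cases
    case (1 i)
    then show ?thesis
      using less[OF 1(1)] s_closed[of i] s_square[of i] by (simp add: gpow_def gen_def numeral_2_eq_2)
  next
    case 2
    then show ?thesis using s02 s012 by (simp add: gen_def m_assoc)
  next
    case (3 i)
    then have "1 \<le> i" "i < n" "i + 1 < n" using n by auto
    then show ?thesis using braid[of i] s_closed[of i] s_closed[of "i + 1"] 3
      by (simp add: gen_def m_assoc)
  next
    case 4
    then show ?thesis using s01 s012 by (simp add: gen_def)
  next
    case (5 i)
    then show ?thesis using less[OF 5(1)] s0i[of i] s_closed[of i] s012 by (simp add: gen_def)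
  next
    case (6 i j)
    then show ?thesis
      using far'[OF 6(1-3)] less[OF 6(1)] less[OF 6(2)] s_closed[of i] s_closed[of j]
      by (simp add: gen_def)
  qed
qed

text \<open>Indexed like the generators of the presentation.\<close>

definition a :: "nat \<Rightarrow> 'a"
  where "a i = (if i = 1 then d 0 else if i = 2 then e else d (i - 2))"

lemma a_closed: "i \<in> {1..n-1} \<Longrightarrow> a i \<in> carrier G"
  using d_closed[of 0] d_closed[of "i - 2"] e_closed n by (auto simp: a_def)

lemma a_cube: "i \<in> {1..n-1} \<Longrightarrow> a i \<otimes> a i \<otimes> a i = \<one>"
  using d_cube[of 0] d_cube[of "i - 2"] e_cube n by (auto simp: a_def)

lemma eval_alt_pres_rels:
  assumes "(v, w) \<in> alt_pres_rels n"
  shows "gword_eval G a v = gword_eval G a w"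
proof -
  have a_pos: "a i = d (i - 2)" if "i \<in> {3..n-1}" for i using that by (simp add: a_def)
  have a12: "a 1 = d 0" "a 2 = e" by (simp_all add: a_def)
  have inv_e: "inv e = e \<otimes> e"
    using e_cube e_closed by (intro inv_equality) (auto simp: m_assoc)
  have two: "gpow u 2 = u @ u" and three: "gpow u 3 = u @ u @ u" for u :: "nat gword"
    by (simp_all add: gpow_def numeral_2_eq_2 numeral_3_eq_3)
  from assms consider i where "i \<in> {1..n-1}" "v = gpow (gen i) 3" "w = []"
    | i where "i \<in> {2..n-1}" "v = gpow (gen 1 @ gen i) 2" "w = []"
    | i where "i \<in> {3..n-1}" "v = gpow (gpow (gen 2) 2 @ gen i) 2" "w = []"
    | i j where "i \<in> {3..n-1}" "j \<in> {3..n-1}" "i < j" "v = gpow (gen i @ gen j) 2" "w = []"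
    unfolding alt_pres_rels_def by auto
  then show ?thesis
  proof cases
    case (1 i)
    then show ?thesis using a_cube[of i] a_closed[of i] by (simp add: three gen_def m_assoc)
  next
    case (2 i)
    have "a 1 \<otimes> a i \<otimes> (a 1 \<otimes> a i) = \<one>"
      using d0_e d_pair0[of "i - 2"] 2 by (auto simp: a_def)
    then show ?thesis using 2 a_closed[of 1] a_closed[of i] by (simp add: two gen_def m_assoc)
  next
    case (3 i)
    have "e \<otimes> e \<otimes> d (i - 2) \<otimes> (e \<otimes> e \<otimes> d (i - 2)) = \<one>"
      using e_pair[of "i - 2"] 3 by (auto simp: inv_e)
    then show ?thesis using 3 e_closed a_closed[of i]
      by (simp add: two gen_def m_assoc a12 a_pos)
  next
    case (4 i j)
    then show ?thesis using d_pair[of "i - 2" "j - 2"] a_closed[of i] a_closed[of j]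
      by (simp add: two gen_def m_assoc a_pos)
  qed
qed

end

lemma coxeter_D_satisfies:
  assumes n: "n \<ge> 3"
  shows "coxeter_D_relations (coxeter_D n) (coxeter_D_gen n) n"
proof -
  interpret group "coxeter_D n"
    unfolding coxeter_D_def by (rule presented_group_is_group)
  let ?ev = "gword_eval (coxeter_D n) (coxeter_D_gen n)"
  have closed: "coxeter_D_gen n i \<in> carrier (coxeter_D n)" if "i < n" for i
    unfolding coxeter_D_def coxeter_D_gen_def using that
    by (intro presented_group_gen_closed) auto
  have rel: "?ev l = ?ev r"
    if "(l, r) \<in> coxeter_D_rels n" "l \<in> gwords {0..n-1}" "r \<in> gwords {0..n-1}" for l r
    using presented_group_relation[OF that]
    by (simp add: coxeter_D_def coxeter_D_gen_def[abs_def])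
  show ?thesis
  proof
    show "3 \<le> n" by fact
    fix i assume i: "i < n"
    show "coxeter_D_gen n i \<in> carrier (coxeter_D n)" by (rule closed[OF i])
    have "?ev (gpow (gen i) 2) = ?ev []"
      using i by (intro rel) (auto simp: coxeter_D_rels_def gpow_def gen_def numeral_2_eq_2)
    then show "coxeter_D_gen n i \<otimes>\<^bsub>coxeter_D n\<^esub> coxeter_D_gen n i = \<one>\<^bsub>coxeter_D n\<^esub>"
      using closed[OF i] by (simp add: gpow_def gen_def numeral_2_eq_2)
  next
    have "?ev (gen 0 @ gen 2 @ gen 0) = ?ev (gen 2 @ gen 0 @ gen 2)"
      using n by (intro rel) (auto simp: coxeter_D_rels_def gen_def)
    then show "coxeter_D_gen n 0 \<otimes>\<^bsub>coxeter_D n\<^esub> coxeter_D_gen n 2 \<otimes>\<^bsub>coxeter_D n\<^esub> coxeter_D_gen n 0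
      = coxeter_D_gen n 2 \<otimes>\<^bsub>coxeter_D n\<^esub> coxeter_D_gen n 0 \<otimes>\<^bsub>coxeter_D n\<^esub> coxeter_D_gen n 2"
      using closed n by (simp add: gen_def m_assoc)
    have "?ev (gen 0 @ gen 1) = ?ev (gen 1 @ gen 0)"
      using n by (intro rel) (auto simp: coxeter_D_rels_def gen_def)
    then show "coxeter_D_gen n 0 \<otimes>\<^bsub>coxeter_D n\<^esub> coxeter_D_gen n 1
      = coxeter_D_gen n 1 \<otimes>\<^bsub>coxeter_D n\<^esub> coxeter_D_gen n 0"
      using closed n by (simp add: gen_def)
  next
    fix i assume i: "1 \<le> i" "i + 1 < n"
    have "?ev (gen i @ gen (i+1) @ gen i) = ?ev (gen (i+1) @ gen i @ gen (i+1))"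
      using i by (intro rel) (auto simp: coxeter_D_rels_def gen_def)
    then show "coxeter_D_gen n i \<otimes>\<^bsub>coxeter_D n\<^esub> coxeter_D_gen n (i+1) \<otimes>\<^bsub>coxeter_D n\<^esub> coxeter_D_gen n i
      = coxeter_D_gen n (i+1) \<otimes>\<^bsub>coxeter_D n\<^esub> coxeter_D_gen n i \<otimes>\<^bsub>coxeter_D n\<^esub> coxeter_D_gen n (i+1)"
      using closed i by (simp add: gen_def m_assoc)
  next
    fix i assume i: "3 \<le> i" "i < n"
    have "?ev (gen 0 @ gen i) = ?ev (gen i @ gen 0)"
      using i by (intro rel) (auto simp: coxeter_D_rels_def gen_def)
    then show "coxeter_D_gen n 0 \<otimes>\<^bsub>coxeter_D n\<^esub> coxeter_D_gen n i
      = coxeter_D_gen n i \<otimes>\<^bsub>coxeter_D n\<^esub> coxeter_D_gen n 0"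
      using closed i by (simp add: gen_def)
  next
    fix i j assume ij: "1 \<le> i" "i + 1 < j" "j < n"
    have "?ev (gen i @ gen j) = ?ev (gen j @ gen i)"
      using ij by (intro rel) (auto simp: coxeter_D_rels_def gen_def)
    then show "coxeter_D_gen n i \<otimes>\<^bsub>coxeter_D n\<^esub> coxeter_D_gen n j
      = coxeter_D_gen n j \<otimes>\<^bsub>coxeter_D n\<^esub> coxeter_D_gen n i"
      using closed ij by (simp add: gen_def)
  qed
qed

lemma coxeter_D_generated:
  assumes n: "n \<ge> 3" and one: "\<one>\<^bsub>coxeter_D n\<^esub> \<in> U"
    and gen: "\<And>u i. \<lbrakk>u \<in> U; i < n\<rbrakk> \<Longrightarrow> u \<otimes>\<^bsub>coxeter_D n\<^esub> coxeter_D_gen n i \<in> U"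
  shows "carrier (coxeter_D n) \<subseteq> U"
proof -
  interpret coxeter_D_relations "coxeter_D n" "coxeter_D_gen n" n
    by (rule coxeter_D_satisfies[OF n])
  have inv: "inv\<^bsub>coxeter_D n\<^esub> coxeter_D_gen n i = coxeter_D_gen n i" if "i < n" for i
    using s_square[OF that] s_closed[OF that] by (intro inv_equality)
  have step: "u \<otimes>\<^bsub>coxeter_D n\<^esub> coxeter_D_gen n i \<in> U"
    "u \<otimes>\<^bsub>coxeter_D n\<^esub> inv\<^bsub>coxeter_D n\<^esub> coxeter_D_gen n i \<in> U" if "u \<in> U" "i \<in> {0..n-1}" for u i
    using gen[of u i] inv[of i] that n by auto
  show ?thesis
    using one step unfolding coxeter_D_def coxeter_D_gen_def by (rule presented_group_generated)
qed

text \<open>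
  Right multiplication by a simple reflection exchanges the two sets, since
  \<open>s\<^sub>i = (s\<^sub>0 s\<^sub>i)\<inverse> s\<^sub>0\<close>.
\<close>

lemma coxeter_D_cosets:
  assumes n: "n \<ge> 3" and A: "subgroup A (coxeter_D n)"
    and a: "\<And>i. i \<in> {1..n-1} \<Longrightarrow> coxeter_D_relations.a (coxeter_D n) (coxeter_D_gen n) i \<in> A"
  shows "carrier (coxeter_D n) \<subseteq> A \<union> (\<lambda>x. x \<otimes>\<^bsub>coxeter_D n\<^esub> coxeter_D_gen n 0) ` A"
    (is "_ \<subseteq> ?U")
proof -
  let ?s = "coxeter_D_gen n"
  interpret Cox: coxeter_D_relations "coxeter_D n" ?s n
    by (rule coxeter_D_satisfies[OF n])
  interpret A: subgroup A "coxeter_D n" by (rule A)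
  have even: "?s 0 \<otimes>\<^bsub>coxeter_D n\<^esub> ?s i \<in> A" if "i < n" for i
  proof (rule Cox.even_words[OF A _ _ that])
    show "Cox.d k \<in> A" if "k + 2 < n" for k
      using a[of 1] a[of "k + 2"] that by (cases "k = 0") (auto simp: Cox.a_def)
    show "Cox.e \<in> A" using a[of 2] n by (simp add: Cox.a_def)
  qed
  have inv_s: "inv\<^bsub>coxeter_D n\<^esub> ?s i = ?s i" if "i < n" for i
    using Cox.s_square[OF that] Cox.s_closed[OF that] by (intro Cox.inv_equality)
  show ?thesis
  proof (rule coxeter_D_generated[OF n])
    show "\<one>\<^bsub>coxeter_D n\<^esub> \<in> ?U" using A.one_closed by simp
    fix u i assume u: "u \<in> ?U" and i: "i < n"
    note c = Cox.s_closed[OF i] Cox.s012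
    from u consider "u \<in> A" | v where "v \<in> A" "u = v \<otimes>\<^bsub>coxeter_D n\<^esub> ?s 0"
      by auto
    then show "u \<otimes>\<^bsub>coxeter_D n\<^esub> ?s i \<in> ?U"
    proof cases
      case 1
      have "u \<otimes>\<^bsub>coxeter_D n\<^esub> ?s i
          = u \<otimes>\<^bsub>coxeter_D n\<^esub> inv\<^bsub>coxeter_D n\<^esub> (?s 0 \<otimes>\<^bsub>coxeter_D n\<^esub> ?s i) \<otimes>\<^bsub>coxeter_D n\<^esub> ?s 0"
        using 1 c n i by (simp add: Cox.inv_mult_group inv_s Cox.m_assoc)
      then show ?thesis using 1 even[OF i] by auto
    next
      case (2 v)
      then show ?thesis using even[OF i] c by (auto simp: Cox.m_assoc)
    qed
  qed
qed

section \<open>The wreath product\<close>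

lemma C2_pow_carrier: "g \<in> carrier (C2_pow n) \<longleftrightarrow> g \<in> {1..n} \<rightarrow>\<^sub>E {0, 1}"
proof -
  have "{0..<2} = {0, 1 :: int}" by auto
  then show ?thesis by (simp add: C2_pow_def carrier_integer_mod_group)
qed

lemma C2_pow_mult: "g \<otimes>\<^bsub>C2_pow n\<^esub> h = (\<lambda>i\<in>{1..n}. (g i + h i) mod 2)"
  by (simp add: C2_pow_def mult_integer_mod_group)

lemma C2_pow_one: "\<one>\<^bsub>C2_pow n\<^esub> = (\<lambda>i\<in>{1..n}. 0)"
  by (simp add: C2_pow_def)

lemma C2_pow_comm_group: "comm_group (C2_pow n)"
proof (rule group.group_comm_groupI)
  show "group (C2_pow n)" unfolding C2_pow_def by (rule product_group) simp
qed (simp add: C2_pow_mult add.commute)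

lemma C2_pow_square: "g \<in> carrier (C2_pow n) \<Longrightarrow> g \<otimes>\<^bsub>C2_pow n\<^esub> g = \<one>\<^bsub>C2_pow n\<^esub>"
  by (force simp: C2_pow_carrier C2_pow_mult C2_pow_one fun_eq_iff PiE_iff restrict_def)

lemma gamma_closed: "gamma n i \<in> carrier (C2_pow n)"
  by (auto simp: C2_pow_carrier gamma_def)

lemma perm_act_closed:
  assumes "\<pi> permutes {1..n}" "g \<in> carrier (C2_pow n)"
  shows "perm_act n \<pi> g \<in> carrier (C2_pow n)"
proof -
  have "inv' \<pi> j \<in> {1..n}" if "j \<in> {1..n}" for j
    using permutes_in_image[OF permutes_inv[OF assms(1)]] that by blast
  then show ?thesis
    using assms(2) by (auto simp: C2_pow_carrier perm_act_def PiE_iff)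
qed

lemma perm_act_mult:
  assumes "\<pi> permutes {1..n}"
  shows "perm_act n \<pi> (g \<otimes>\<^bsub>C2_pow n\<^esub> h) = perm_act n \<pi> g \<otimes>\<^bsub>C2_pow n\<^esub> perm_act n \<pi> h"
proof
  fix j
  have "inv' \<pi> j \<in> {1..n} \<longleftrightarrow> j \<in> {1..n}"
    using permutes_in_image[OF permutes_inv[OF assms]] .
  then show "perm_act n \<pi> (g \<otimes>\<^bsub>C2_pow n\<^esub> h) j
      = (perm_act n \<pi> g \<otimes>\<^bsub>C2_pow n\<^esub> perm_act n \<pi> h) j"
    by (auto simp: perm_act_def C2_pow_mult)
qed

lemma perm_act_one:
  assumes "\<pi> permutes {1..n}"
  shows "perm_act n \<pi> \<one>\<^bsub>C2_pow n\<^esub> = \<one>\<^bsub>C2_pow n\<^esub>"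
proof
  fix j
  have "inv' \<pi> j \<in> {1..n} \<longleftrightarrow> j \<in> {1..n}"
    using permutes_in_image[OF permutes_inv[OF assms]] .
  then show "perm_act n \<pi> \<one>\<^bsub>C2_pow n\<^esub> j = \<one>\<^bsub>C2_pow n\<^esub> j"
    by (auto simp: perm_act_def C2_pow_one)
qed

lemma perm_act_comp:
  assumes "\<pi> permutes {1..n}" "\<sigma> permutes {1..n}"
  shows "perm_act n \<pi> (perm_act n \<sigma> g) = perm_act n (\<pi> \<circ> \<sigma>) g"
proof
  fix j
  have "inv' \<pi> j \<in> {1..n} \<longleftrightarrow> j \<in> {1..n}"
    using permutes_in_image[OF permutes_inv[OF assms(1)]] .
  moreover have "inv' (\<pi> \<circ> \<sigma>) = inv' \<sigma> \<circ> inv' \<pi>"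
    using assms by (simp add: o_inv_distrib permutes_bij)
  ultimately show "perm_act n \<pi> (perm_act n \<sigma> g) j = perm_act n (\<pi> \<circ> \<sigma>) g j"
    by (auto simp: perm_act_def)
qed

lemma perm_act_id: "g \<in> carrier (C2_pow n) \<Longrightarrow> perm_act n id g = g"
  by (auto simp: perm_act_def C2_pow_carrier PiE_iff extensional_def fun_eq_iff)

lemma C2_pow_sign_mult:
  assumes "g \<in> carrier (C2_pow n)" "h \<in> carrier (C2_pow n)"
  shows "C2_pow_sign n (g \<otimes>\<^bsub>C2_pow n\<^esub> h) = C2_pow_sign n g * C2_pow_sign n h"
  unfolding C2_pow_sign_def prod.distrib[symmetric]
proof (rule prod.cong)
  fix i assume i: "i \<in> {1..n}"
  then have "g i \<in> {0, 1}" "h i \<in> {0, 1}"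
    using assms unfolding C2_pow_carrier by blast+
  then show "(if (g \<otimes>\<^bsub>C2_pow n\<^esub> h) i = 1 then - 1 else 1 :: int)
      = (if g i = 1 then - 1 else 1) * (if h i = 1 then - 1 else 1)"
    using i by (auto simp: C2_pow_mult)
qed simp

lemma C2_pow_sign_perm_act:
  assumes "\<pi> permutes {1..n}"
  shows "C2_pow_sign n (perm_act n \<pi> g) = C2_pow_sign n g"
proof -
  have "C2_pow_sign n g = (\<Prod>i\<in>{1..n}. if g (inv' \<pi> i) = 1 then - 1 else 1)"
    unfolding C2_pow_sign_def
    using prod.permute[OF permutes_inv[OF assms], of "\<lambda>i. if g i = 1 then - 1 else 1 :: int"]
    by (simp add: comp_def)
  then show ?thesis unfolding C2_pow_sign_def perm_act_def by simp
qed

lemma C2_pow_sign_gamma: "i \<in> {1..n} \<Longrightarrow> C2_pow_sign n (gamma n i) = - 1"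
proof -
  assume i: "i \<in> {1..n}"
  have "C2_pow_sign n (gamma n i) = (\<Prod>j\<in>{1..n}. if j = i then - 1 else 1)"
    unfolding C2_pow_sign_def gamma_def by (intro prod.cong) auto
  then show ?thesis using i by simp
qed

lemma C2_wreath_carrier:
  "(g, \<pi>) \<in> carrier (C2_wreath n) \<longleftrightarrow> g \<in> carrier (C2_pow n) \<and> \<pi> permutes {1..n}"
  by (simp add: C2_wreath_def sym_group_def)

lemma C2_wreath_mult:
  "(g, \<pi>) \<otimes>\<^bsub>C2_wreath n\<^esub> (h, \<sigma>) = (g \<otimes>\<^bsub>C2_pow n\<^esub> perm_act n \<pi> h, \<pi> \<circ> \<sigma>)"
  by (simp add: C2_wreath_def sym_group_def)

lemma C2_wreath_one: "\<one>\<^bsub>C2_wreath n\<^esub> = (\<one>\<^bsub>C2_pow n\<^esub>, id)"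
  by (simp add: C2_wreath_def sym_group_def)

lemma C2_wreath_group: "group (C2_wreath n)"
proof -
  interpret C: comm_group "C2_pow n" by (rule C2_pow_comm_group)
  show ?thesis
  proof (rule groupI)
    show "\<one>\<^bsub>C2_wreath n\<^esub> \<in> carrier (C2_wreath n)"
      by (simp add: C2_wreath_one C2_wreath_carrier permutes_id)
    fix x assume "x \<in> carrier (C2_wreath n)"
    then obtain g \<pi> where x: "x = (g, \<pi>)" "g \<in> carrier (C2_pow n)" "\<pi> permutes {1..n}"
      by (cases x) (simp add: C2_wreath_carrier)
    show "\<one>\<^bsub>C2_wreath n\<^esub> \<otimes>\<^bsub>C2_wreath n\<^esub> x = x"
      using x by (simp add: C2_wreath_one C2_wreath_mult perm_act_id)
    have "(perm_act n (inv' \<pi>) g, inv' \<pi>) \<otimes>\<^bsub>C2_wreath n\<^esub> x = \<one>\<^bsub>C2_wreath n\<^esub>"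
      using x by (simp add: C2_wreath_one C2_wreath_mult C2_pow_square perm_act_closed
        permutes_inv permutes_inv_o)
    then show "\<exists>y\<in>carrier (C2_wreath n). y \<otimes>\<^bsub>C2_wreath n\<^esub> x = \<one>\<^bsub>C2_wreath n\<^esub>"
      using x by (intro bexI[of _ "(perm_act n (inv' \<pi>) g, inv' \<pi>)"])
        (simp_all add: C2_wreath_carrier permutes_inv perm_act_closed)
    fix y assume "y \<in> carrier (C2_wreath n)"
    then obtain h \<sigma> where y: "y = (h, \<sigma>)" "h \<in> carrier (C2_pow n)" "\<sigma> permutes {1..n}"
      by (cases y) (simp add: C2_wreath_carrier)
    show "x \<otimes>\<^bsub>C2_wreath n\<^esub> y \<in> carrier (C2_wreath n)"
      using x y by (simp add: C2_wreath_mult C2_wreath_carrier perm_act_closed permutes_compose)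
    fix z assume "z \<in> carrier (C2_wreath n)"
    then obtain k \<tau> where z: "z = (k, \<tau>)" "k \<in> carrier (C2_pow n)" "\<tau> permutes {1..n}"
      by (cases z) (simp add: C2_wreath_carrier)
    show "x \<otimes>\<^bsub>C2_wreath n\<^esub> y \<otimes>\<^bsub>C2_wreath n\<^esub> z = x \<otimes>\<^bsub>C2_wreath n\<^esub> (y \<otimes>\<^bsub>C2_wreath n\<^esub> z)"
      using x y z by (simp add: C2_wreath_mult perm_act_mult perm_act_comp perm_act_closed
        permutes_compose C.m_assoc comp_assoc)
  qed
qed

lemma wreath_D_carrier: "x \<in> carrier (wreath_D n) \<longleftrightarrow>
    x \<in> carrier (C2_wreath n) \<and> C2_pow_sign n (fst x) = 1"
  by (cases x) (simp add: wreath_D_def)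

lemma wreath_D_mult: "x \<otimes>\<^bsub>wreath_D n\<^esub> y = x \<otimes>\<^bsub>C2_wreath n\<^esub> y"
  by (simp add: wreath_D_def)

lemma wreath_D_one: "\<one>\<^bsub>wreath_D n\<^esub> = \<one>\<^bsub>C2_wreath n\<^esub>"
  by (simp add: wreath_D_def)

lemma C2_wreath_sign_hom: "(\<lambda>x. C2_pow_sign n (fst x)) \<in> hom (C2_wreath n) sign_img"
proof (rule homI)
  fix x y assume "x \<in> carrier (C2_wreath n)" "y \<in> carrier (C2_wreath n)"
  then show "C2_pow_sign n (fst (x \<otimes>\<^bsub>C2_wreath n\<^esub> y))
      = C2_pow_sign n (fst x) \<otimes>\<^bsub>sign_img\<^esub> C2_pow_sign n (fst y)"
    by (cases x; cases y) (simp add: C2_wreath_mult C2_wreath_carrier C2_pow_sign_mult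
      perm_act_closed C2_pow_sign_perm_act sign_img_def)
  have "C2_pow_sign n g \<in> {-1, 1}" for g
    unfolding C2_pow_sign_def by (induction n) (auto simp: prod.nat_ivl_Suc')
  then show "C2_pow_sign n (fst x) \<in> carrier sign_img"
    by (simp add: sign_img_def)
qed

lemma wreath_D_subgroup: "subgroup (carrier (wreath_D n)) (C2_wreath n)"
proof -
  interpret group_hom "C2_wreath n" sign_img "\<lambda>x. C2_pow_sign n (fst x)"
    by (intro group_hom.intro group_hom_axioms.intro C2_wreath_group sign_img_is_group
      C2_wreath_sign_hom)
  have "carrier (wreath_D n) = kernel (C2_wreath n) sign_img (\<lambda>x. C2_pow_sign n (fst x))"
    by (auto simp: wreath_D_carrier kernel_def sign_img_def)
  then show ?thesis using subgroup_kernel by simp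
qed

lemma wreath_D_group: "group (wreath_D n)"
proof -
  interpret group "C2_wreath n" by (rule C2_wreath_group)
  show ?thesis
    using subgroup.subgroup_is_group[OF wreath_D_subgroup is_group]
    by (simp add: wreath_D_def)
qed

lemma C2_wreath_card: "finite (carrier (C2_wreath n))" "card (carrier (C2_wreath n)) = 2 ^ n * fact n"
proof -
  have eq: "carrier (C2_wreath n) = ({1..n} \<rightarrow>\<^sub>E {0, 1}) \<times> {\<pi>. \<pi> permutes {1..n}}"
    by (simp only: set_eq_iff split_paired_All C2_wreath_carrier C2_pow_carrier mem_Times_iff
      mem_Collect_eq fst_conv snd_conv simp_thms)
  show "finite (carrier (C2_wreath n))"
    unfolding eq by (intro finite_cartesian_product finite_PiE finite_permutations) auto
  show "card (carrier (C2_wreath n)) = 2 ^ n * fact n"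
    unfolding eq card_cartesian_product
    by (simp add: card_PiE card_permutations[of _ n] numeral_2_eq_2)
qed

lemma C2_pow_cancel:
  assumes "g \<in> carrier (C2_pow n)" "h \<in> carrier (C2_pow n)"
  shows "g \<otimes>\<^bsub>C2_pow n\<^esub> (g \<otimes>\<^bsub>C2_pow n\<^esub> h) = h"
proof -
  interpret C: comm_group "C2_pow n" by (rule C2_pow_comm_group)
  show ?thesis using assms C2_pow_square[OF assms(1)] by (simp flip: C.m_assoc)
qed

lemma gen_image_0:
  "coxeter_D_gen_image n 0 = (gamma n 1 \<otimes>\<^bsub>C2_pow n\<^esub> gamma n 2, transpose 1 2)"
  by (simp add: coxeter_D_gen_image_def)

lemma gen_image_pos: "1 \<le> i \<Longrightarrow> coxeter_D_gen_image n i = (\<one>\<^bsub>C2_pow n\<^esub>, transpose i (i + 1))"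
  by (simp add: coxeter_D_gen_image_def)

lemma adjacent_permutes: "\<lbrakk>1 \<le> i; i < (n :: nat)\<rbrakk> \<Longrightarrow> transpose i (i + 1) permutes {1..n}"
  by (intro permutes_swap_id) auto

lemma wreath_D_relations:
  assumes n: "n \<ge> 3"
  shows "coxeter_D_relations (wreath_D n) (coxeter_D_gen_image n) n"
proof -
  interpret group "wreath_D n" by (rule wreath_D_group)
  interpret C: comm_group "C2_pow n" by (rule C2_pow_comm_group)
  have p12: "transpose 1 2 permutes {1..n}" and p23: "transpose 2 3 permutes {1..n}"
    using n by (auto intro: permutes_swap_id)
  have s1: "coxeter_D_gen_image n 1 = (\<one>\<^bsub>C2_pow n\<^esub>, transpose 1 2)"
    and s2: "coxeter_D_gen_image n 2 = (\<one>\<^bsub>C2_pow n\<^esub>, transpose 2 3)"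
    using gen_image_pos[of 1 n] gen_image_pos[of 2 n] by (simp_all del: One_nat_def)
  note wreath_simps = wreath_D_mult wreath_D_one C2_wreath_mult C2_wreath_one perm_act_one
    perm_act_mult perm_act_gamma gamma_closed permutes_compose C2_pow_cancel C2_pow_square C.m_assoc
  show ?thesis
  proof
    show "3 \<le> n" by fact
    fix i assume i: "i < n"
    have sign_one: "C2_pow_sign n \<one>\<^bsub>C2_pow n\<^esub> = 1"
      by (auto simp: C2_pow_sign_def C2_pow_one intro!: prod.neutral)
    show "coxeter_D_gen_image n i \<in> carrier (wreath_D n)"
    proof (cases "i = 0")
      case True
      then show ?thesis using n p12
        by (simp add: gen_image_0 wreath_D_carrier C2_wreath_carrier C2_pow_sign_mult gamma_closed
          C2_pow_sign_gamma)
    next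
      case False
      then show ?thesis using adjacent_permutes[of i n] i
        by (simp add: gen_image_pos wreath_D_carrier C2_wreath_carrier sign_one)
    qed
    show "coxeter_D_gen_image n i \<otimes>\<^bsub>wreath_D n\<^esub> coxeter_D_gen_image n i = \<one>\<^bsub>wreath_D n\<^esub>"
    proof (cases "i = 0")
      case True
      then show ?thesis using p12
        by (simp add: gen_image_0 wreath_simps del: One_nat_def)
    next
      case False
      then show ?thesis using adjacent_permutes[of i n] i
        by (simp add: gen_image_pos wreath_simps del: One_nat_def)
    qed
  next
    have "transpose 1 2 \<circ> transpose 2 3 \<circ> transpose 1 2
        = transpose 2 3 \<circ> transpose 1 2 \<circ> transpose 2 (3 :: nat)"
      by (auto simp: fun_eq_iff transpose_def)
    then show "coxeter_D_gen_image n 0 \<otimes>\<^bsub>wreath_D n\<^esub> coxeter_D_gen_image n 2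
        \<otimes>\<^bsub>wreath_D n\<^esub> coxeter_D_gen_image n 0
      = coxeter_D_gen_image n 2 \<otimes>\<^bsub>wreath_D n\<^esub> coxeter_D_gen_image n 0
        \<otimes>\<^bsub>wreath_D n\<^esub> coxeter_D_gen_image n 2"
      using p12 p23 by (simp add: gen_image_0 s2 wreath_simps transpose_def del: One_nat_def)
    show "coxeter_D_gen_image n 0 \<otimes>\<^bsub>wreath_D n\<^esub> coxeter_D_gen_image n 1
      = coxeter_D_gen_image n 1 \<otimes>\<^bsub>wreath_D n\<^esub> coxeter_D_gen_image n 0"
      using p12 C.m_comm[OF gamma_closed gamma_closed, of 1 2]
      by (simp add: gen_image_0 s1 wreath_simps del: One_nat_def)
  next
    fix i assume i: "1 \<le> i" "i + 1 < n"
    have "transpose i (i + 1) \<circ> transpose (i + 1) (i + 1 + 1) \<circ> transpose i (i + 1)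
        = transpose (i + 1) (i + 1 + 1) \<circ> transpose i (i + 1) \<circ> transpose (i + 1) (i + 1 + 1)"
      by (auto simp: fun_eq_iff transpose_def)
    then show "coxeter_D_gen_image n i \<otimes>\<^bsub>wreath_D n\<^esub> coxeter_D_gen_image n (i + 1)
        \<otimes>\<^bsub>wreath_D n\<^esub> coxeter_D_gen_image n i
      = coxeter_D_gen_image n (i + 1) \<otimes>\<^bsub>wreath_D n\<^esub> coxeter_D_gen_image n i
        \<otimes>\<^bsub>wreath_D n\<^esub> coxeter_D_gen_image n (i + 1)"
      using i adjacent_permutes[of i n] adjacent_permutes[of "i + 1" n]
      by (simp add: gen_image_pos wreath_simps del: One_nat_def)
  next
    fix i assume i: "3 \<le> i" "i < n"
    have "transpose 1 2 \<circ> transpose i (i + 1) = transpose i (i + 1) \<circ> transpose 1 2"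
      using i by (auto simp: fun_eq_iff transpose_def)
    then show "coxeter_D_gen_image n 0 \<otimes>\<^bsub>wreath_D n\<^esub> coxeter_D_gen_image n i
      = coxeter_D_gen_image n i \<otimes>\<^bsub>wreath_D n\<^esub> coxeter_D_gen_image n 0"
      using i p12 adjacent_permutes[of i n]
      by (simp add: gen_image_0 gen_image_pos wreath_simps del: One_nat_def)
  next
    fix i j assume ij: "1 \<le> i" "i + 1 < j" "j < n"
    have "transpose i (i + 1) \<circ> transpose j (j + 1) = transpose j (j + 1) \<circ> transpose i (i + 1)"
      using ij by (auto simp: fun_eq_iff transpose_def)
    then show "coxeter_D_gen_image n i \<otimes>\<^bsub>wreath_D n\<^esub> coxeter_D_gen_image n j
      = coxeter_D_gen_image n j \<otimes>\<^bsub>wreath_D n\<^esub> coxeter_D_gen_image n i"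
      using ij adjacent_permutes[of i n] adjacent_permutes[of j n]
      by (simp add: gen_image_pos wreath_simps del: One_nat_def)
  qed
qed

text \<open>
  The subgroup generated by the images of the Coxeter generators has index at most 2. It contains
  the symmetric group and, as conjugates of the image of \<open>s\<^sub>0 s\<^sub>1\<close>, all products \<open>\<gamma>\<^sub>1 \<gamma>\<^sub>b\<close>; modulo
  these, every element of the base group is a power of \<open>\<gamma>\<^sub>1\<close>.
\<close>

lemma wreath_generated:
  assumes n: "n \<ge> 3" and I: "subgroup I (C2_wreath n)"
    and gens: "\<And>i. i < n \<Longrightarrow> coxeter_D_gen_image n i \<in> I"
    and x: "x \<in> carrier (C2_wreath n)"
  shows "x \<in> I \<or> (gamma n 1, id) \<otimes>\<^bsub>C2_wreath n\<^esub> x \<in> I"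
proof -
  interpret C: comm_group "C2_pow n" by (rule C2_pow_comm_group)
  interpret W: group "C2_wreath n" by (rule C2_wreath_group)
  interpret I: subgroup I "C2_wreath n" by (rule I)
  have mult: "(g, \<pi>) \<in> I \<Longrightarrow> (h, \<sigma>) \<in> I \<Longrightarrow> (g \<otimes>\<^bsub>C2_pow n\<^esub> perm_act n \<pi> h, \<pi> \<circ> \<sigma>) \<in> I"
    for g h \<pi> \<sigma>
    using I.m_closed[of "(g, \<pi>)" "(h, \<sigma>)"] by (simp add: C2_wreath_mult)
  have adjacent: "(\<one>\<^bsub>C2_pow n\<^esub>, transpose i (i + 1)) \<in> I" if "1 \<le> i" "i < n" for i
    using gens[of i] gen_image_pos that by simp
  have comp: "(\<one>\<^bsub>C2_pow n\<^esub>, \<pi> \<circ> \<sigma>) \<in> I"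
    if "(\<one>\<^bsub>C2_pow n\<^esub>, \<pi>) \<in> I" "(\<one>\<^bsub>C2_pow n\<^esub>, \<sigma>) \<in> I" "\<pi> permutes {1..n}" for \<pi> \<sigma>
    using mult[OF that(1,2)] that(3) by (simp add: perm_act_one)
  have less: "(\<one>\<^bsub>C2_pow n\<^esub>, transpose a b) \<in> I" if "1 \<le> a" "a + 1 \<le> b" "b \<le> n" for a b
    using that(2,3)
  proof (induction b rule: dec_induct)
    case base
    then show ?case using adjacent[of a] that(1) by simp
  next
    case (step b)
    have "transpose a (Suc b) = transpose (Suc b) b \<circ> transpose b a \<circ> transpose (Suc b) b"
      using step by (subst transpose_comp_triple) (auto simp: transpose_commute)
    then have eq: "transpose a (Suc b) = transpose b (b + 1) \<circ> (transpose a b \<circ> transpose b (b + 1))"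
      by (simp add: transpose_commute comp_assoc)
    show ?case
      unfolding eq using step that(1) adjacent[of b]
      by (intro comp adjacent_permutes permutes_swap_id) auto
  qed
  have transp: "(\<one>\<^bsub>C2_pow n\<^esub>, transpose a b) \<in> I" if "a \<in> {1..n}" "b \<in> {1..n}" "a \<noteq> b" for a b
    using less[of a b] less[of b a] that
    by (cases "a < b") (auto simp: transpose_commute)
  have perm: "(\<one>\<^bsub>C2_pow n\<^esub>, \<pi>) \<in> I" if "\<pi> permutes {1..n}" for \<pi>
    using that finite_atLeastAtMost
  proof (induction \<pi> rule: permutes_induct)
    case id
    then show ?case using I.one_closed by (simp add: C2_wreath_one id_def)
  next
    case (swap a b \<pi>)
    then show ?case using transp
      by (intro comp permutes_swap_id) auto
  qed
  have p12: "transpose 1 2 permutes {1..n}"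
    using n by (auto intro: permutes_swap_id)
  have "(gamma n 1 \<otimes>\<^bsub>C2_pow n\<^esub> gamma n 2, transpose 1 2) \<in> I"
    using gens[of 0] n by (simp add: gen_image_0)
  from mult[OF this perm[OF p12]]
  have g12: "(gamma n 1 \<otimes>\<^bsub>C2_pow n\<^esub> gamma n 2, id) \<in> I"
    using p12 by (simp add: perm_act_one gamma_closed)
  have g1: "(gamma n 1 \<otimes>\<^bsub>C2_pow n\<^esub> gamma n b, id) \<in> I" if b: "b \<in> {1..n}" for b
  proof (cases "b = 1")
    case True
    then show ?thesis using I.one_closed by (simp add: C2_pow_square gamma_closed C2_wreath_one)
  next
    case False
    have p: "transpose 2 b permutes {1..n}" using b n by (intro permutes_swap_id) auto
    have "(\<one>\<^bsub>C2_pow n\<^esub> \<otimes>\<^bsub>C2_pow n\<^esub> perm_act n (transpose 2 b) (gamma n 1 \<otimes>\<^bsub>C2_pow n\<^esub> gamma n 2),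
        transpose 2 b \<circ> id) \<in> I"
      by (rule mult[OF perm[OF p] g12])
    from mult[OF this perm[OF p]] show ?thesis
      using p False by (simp add: perm_act_one perm_act_mult perm_act_gamma gamma_closed del: One_nat_def)
  qed
  have ind: "(h, id) \<in> I \<or> (gamma n 1 \<otimes>\<^bsub>C2_pow n\<^esub> h, id) \<in> I"
    if "finite B" "B \<subseteq> {1..n}" "h = (\<lambda>i\<in>{1..n}. if i \<in> B then 1 else 0)" for B h
    using that
  proof (induction B arbitrary: h rule: finite_induct)
    case empty
    then have "h = \<one>\<^bsub>C2_pow n\<^esub>" by (auto simp: C2_pow_one fun_eq_iff)
    then show ?case using I.one_closed by (simp add: C2_wreath_one id_def)
  next
    case (insert b B)
    define k :: "nat \<Rightarrow> int" where "k = (\<lambda>i\<in>{1..n}. if i \<in> B then 1 else 0)"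
    have k: "k \<in> carrier (C2_pow n)" by (auto simp: k_def C2_pow_carrier)
    have h: "h = gamma n b \<otimes>\<^bsub>C2_pow n\<^esub> k"
      unfolding insert.prems(2) k_def C2_pow_mult gamma_def using insert.hyps
      by (auto simp: fun_eq_iff)
    have b: "b \<in> {1..n}" using insert by auto
    have "(k, id) \<in> I \<or> (gamma n 1 \<otimes>\<^bsub>C2_pow n\<^esub> k, id) \<in> I"
      by (rule insert.IH[OF _ k_def]) (use insert.prems(1) in blast)
    then consider "(k, id) \<in> I" | "(gamma n 1 \<otimes>\<^bsub>C2_pow n\<^esub> k, id) \<in> I"
      by blast
    then show ?case
    proof cases
      case 1
      from mult[OF g1[OF b] this] have "(gamma n 1 \<otimes>\<^bsub>C2_pow n\<^esub> h, id) \<in> I"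
        using k by (simp add: h perm_act_id C.m_assoc gamma_closed)
      then show ?thesis by (simp add: id_def)
    next
      case 2
      from mult[OF g1[OF b] this] have "(h, id) \<in> I"
        using k by (simp add: h perm_act_id C.m_ac gamma_closed C2_pow_square)
      then show ?thesis by (simp add: id_def)
    qed
  qed
  obtain g \<pi> where gp: "x = (g, \<pi>)" "g \<in> carrier (C2_pow n)" "\<pi> permutes {1..n}"
    using x by (cases x) (simp add: C2_wreath_carrier)
  have "g = (\<lambda>i\<in>{1..n}. if i \<in> {j \<in> {1..n}. g j = 1} then 1 else 0)"
    using gp(2) by (force simp: C2_pow_carrier fun_eq_iff PiE_iff extensional_def)
  from ind[OF _ _ this] have "(g, id) \<in> I \<or> (gamma n 1 \<otimes>\<^bsub>C2_pow n\<^esub> g, id) \<in> I"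
    by fastforce
  then consider "(g, id) \<in> I" | "(gamma n 1 \<otimes>\<^bsub>C2_pow n\<^esub> g, id) \<in> I"
    by blast
  then show ?thesis
  proof cases
    case 1
    from mult[OF this perm[OF gp(3)]] show ?thesis
      using gp by (simp add: perm_act_id)
  next
    case 2
    from mult[OF this perm[OF gp(3)]] show ?thesis
      using gp by (simp add: perm_act_id C2_wreath_mult gamma_closed)
  qed
qed

lemma wreath_a:
  assumes n: "n \<ge> 3" and i: "i \<in> {1..n-1}"
  shows "coxeter_D_relations.a (wreath_D n) (coxeter_D_gen_image n) i = alt_pres_gen_image n i"
proof -
  interpret Wr: coxeter_D_relations "wreath_D n" "coxeter_D_gen_image n" n
    by (rule wreath_D_relations[OF n])
  interpret C: comm_group "C2_pow n" by (rule C2_pow_comm_group)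
  have p12: "transpose 1 2 permutes {1..n}" and p23: "transpose 2 3 permutes {1..n}"
    using n by (auto intro: permutes_swap_id)
  have s1: "coxeter_D_gen_image n 1 = (\<one>\<^bsub>C2_pow n\<^esub>, transpose 1 2)"
    and s2: "coxeter_D_gen_image n 2 = (\<one>\<^bsub>C2_pow n\<^esub>, transpose 2 3)"
    using gen_image_pos[of 1 n] gen_image_pos[of 2 n] by (simp_all del: One_nat_def)
  have r: "Wr.r k = (\<one>\<^bsub>C2_pow n\<^esub>, transpose 2 (k + 3))" if "k + 2 < n" for k
    using that
  proof (induction k)
    case 0
    then show ?case using s2 by simp
  next
    case (Suc k)
    have p: "transpose (k + 3) (k + 4) permutes {1..n}" "transpose 2 (k + 3) permutes {1..n}"
      using Suc.prems by (auto intro!: permutes_swap_id)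
    have "transpose (k + 4) (k + 3) \<circ> transpose (k + 3) 2 \<circ> transpose (k + 4) (k + 3)
        = transpose (k + 4) 2"
      by (rule transpose_comp_triple) auto
    then have t: "transpose (k + 3) (k + 4) \<circ> transpose 2 (k + 3) \<circ> transpose (k + 3) (k + 4)
        = transpose 2 (k + 4)"
      by (simp add: transpose_commute)
    have "coxeter_D_gen_image n (k + 3) = (\<one>\<^bsub>C2_pow n\<^esub>, transpose (k + 3) (k + 4))"
      using gen_image_pos[of "k + 3" n] by (simp add: numeral_eq_Suc)
    moreover have "Wr.r (Suc k) = coxeter_D_gen_image n (k + 3) \<otimes>\<^bsub>wreath_D n\<^esub>
        (\<one>\<^bsub>C2_pow n\<^esub>, transpose 2 (k + 3)) \<otimes>\<^bsub>wreath_D n\<^esub> coxeter_D_gen_image n (k + 3)"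
      using Suc by simp
    ultimately have "Wr.r (Suc k) = (\<one>\<^bsub>C2_pow n\<^esub>, transpose 2 (k + 4))"
      using p t by (simp add: wreath_D_mult C2_wreath_mult perm_act_one permutes_compose)
    then show ?case by (simp add: numeral_eq_Suc)
  qed
  have d: "Wr.d k = (gamma n 1 \<otimes>\<^bsub>C2_pow n\<^esub> gamma n 2, transpose 1 2 \<circ> transpose 2 (k + 3))"
    if "k + 2 < n" for k
    using r[OF that] p12
    by (simp add: Wr.d_def gen_image_0 wreath_D_mult C2_wreath_mult perm_act_one gamma_closed
      del: One_nat_def)
  have "transpose 1 2 \<circ> (transpose 1 2 \<circ> transpose 2 3) \<circ> transpose 1 2
      = transpose 1 3 \<circ> transpose 3 (2 :: nat)"
    by (auto simp: fun_eq_iff transpose_def)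
  then have e: "Wr.e = (gamma n 1 \<otimes>\<^bsub>C2_pow n\<^esub> gamma n 2, transpose 1 3 \<circ> transpose 3 2)"
    using p12 p23 C.m_comm[OF gamma_closed gamma_closed, of 1 2]
    by (simp add: Wr.e_def gen_image_0 s1 s2 wreath_D_mult C2_wreath_mult perm_act_one perm_act_mult
      perm_act_gamma gamma_closed permutes_compose del: One_nat_def)
  consider "i = 1" | "i = 2" | "3 \<le> i" using i by force
  then show ?thesis
  proof cases
    case 1
    then show ?thesis using d[of 0] n by (simp add: Wr.a_def alt_pres_gen_image_def)
  next
    case 2
    then show ?thesis using e by (simp add: Wr.a_def alt_pres_gen_image_def)
  next
    case 3
    then have "i - 2 + 3 = i + 1" by simp
    then show ?thesis using d[of "i - 2"] i 3 by (simp add: Wr.a_def alt_pres_gen_image_def)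
  qed
qed

lemma wreath_D_generated:
  assumes n: "n \<ge> 3" and I: "subgroup I (C2_wreath n)" and I_sub: "I \<subseteq> carrier (wreath_D n)"
    and gens: "\<And>i. i < n \<Longrightarrow> coxeter_D_gen_image n i \<in> I"
  shows "I = carrier (wreath_D n)" and "2 ^ n * fact n \<le> 2 * card I"
proof -
  interpret W: group "C2_wreath n" by (rule C2_wreath_group)
  define g where "g = (gamma n 1, id :: nat \<Rightarrow> nat)"
  have g: "g \<in> carrier (C2_wreath n)"
    by (simp add: g_def C2_wreath_carrier gamma_closed permutes_id)
  have gg: "g \<otimes>\<^bsub>C2_wreath n\<^esub> g = \<one>\<^bsub>C2_wreath n\<^esub>"
    by (simp add: g_def C2_wreath_mult C2_wreath_one perm_act_id gamma_closed C2_pow_square)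
  have cosets: "x \<in> I \<or> g \<otimes>\<^bsub>C2_wreath n\<^esub> x \<in> I" if "x \<in> carrier (C2_wreath n)" for x
    using wreath_generated[OF n I gens that] by (simp add: g_def)
  show "I = carrier (wreath_D n)"
  proof
    show "carrier (wreath_D n) \<subseteq> I"
    proof
      fix x assume x: "x \<in> carrier (wreath_D n)"
      then have xW: "x \<in> carrier (C2_wreath n)" by (simp add: wreath_D_carrier)
      have "C2_pow_sign n (fst (g \<otimes>\<^bsub>C2_wreath n\<^esub> x)) = - 1"
        using x n by (cases x) (simp add: g_def wreath_D_carrier C2_wreath_carrier C2_wreath_mult
          perm_act_id C2_pow_sign_mult gamma_closed C2_pow_sign_gamma)
      then have "g \<otimes>\<^bsub>C2_wreath n\<^esub> x \<notin> I"
        using I_sub by (auto simp: wreath_D_carrier)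
      then show "x \<in> I" using cosets[OF xW] by simp
    qed
  qed (rule I_sub)
  have finI: "finite I"
    by (rule finite_subset[OF subgroup.subset[OF I] C2_wreath_card(1)])
  have "carrier (C2_wreath n) \<subseteq> I \<union> (\<lambda>x. g \<otimes>\<^bsub>C2_wreath n\<^esub> x) ` I"
  proof
    fix x assume x: "x \<in> carrier (C2_wreath n)"
    have "x = g \<otimes>\<^bsub>C2_wreath n\<^esub> (g \<otimes>\<^bsub>C2_wreath n\<^esub> x)"
      using g x gg by (simp flip: W.m_assoc)
    then show "x \<in> I \<union> (\<lambda>x. g \<otimes>\<^bsub>C2_wreath n\<^esub> x) ` I"
      using cosets[OF x] by blast
  qed
  then have "2 ^ n * fact n \<le> card (I \<union> (\<lambda>x. g \<otimes>\<^bsub>C2_wreath n\<^esub> x) ` I)"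
    unfolding C2_wreath_card(2)[symmetric] using finI by (intro card_mono) auto
  also have "\<dots> \<le> card I + card I"
    using card_image_le[OF finI] by (meson add_left_mono card_Un_le order.trans)
  finally show "2 ^ n * fact n \<le> 2 * card I" by simp
qed

section \<open>The isomorphisms\<close>

lemma sign_img_ops: "\<one>\<^bsub>sign_img\<^esub> = 1" "x \<otimes>\<^bsub>sign_img\<^esub> y = x * y"
  by (simp_all add: sign_img_def)

theorem mainTheorem7:
  fixes n :: nat
  assumes "n \<ge> 3"
  shows "\<exists>\<phi> \<psi>.
      \<phi> \<in> iso (coxeter_D n) (wreath_D n)
    \<and> (\<forall>i\<in>{0..n-1}. \<phi> (coxeter_D_gen n i) = coxeter_D_gen_image n i)
    \<and> \<phi> ` carrier (alternating_D n) = carrier (wreath_D_plus n)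
    \<and> \<psi> \<in> iso (alt_pres n) (alternating_D n)
    \<and> (\<forall>i\<in>{1..n-1}. \<phi> (\<psi> (alt_pres_gen n i)) = alt_pres_gen_image n i)"
proof -
  interpret Cox: coxeter_D_relations "coxeter_D n" "coxeter_D_gen n" n
    by (rule coxeter_D_satisfies[OF assms])
  interpret Wr: coxeter_D_relations "wreath_D n" "coxeter_D_gen_image n" n
    by (rule wreath_D_relations[OF assms])
  interpret Alt: group "alt_pres n"
    unfolding alt_pres_def by (rule presented_group_is_group)
  have "2 \<le> n" using assms by simp
  then have "2 ^ n = (2 ^ (n - 2) * 2 ^ 2 :: nat)"
    using power_add[of "2 :: nat" "n - 2" 2] by (simp only: le_add_diff_inverse2)
  then have four: "2 ^ n * fact n = 4 * (2 ^ (n - 2) * fact n :: nat)"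
    by simp
  let ?s = "coxeter_D_gen n"

  define \<phi> where "\<phi> = presented_hom (wreath_D n) (coxeter_D_gen_image n)"
  have "coxeter_D_gen_image n ` {0..n-1} \<subseteq> carrier (wreath_D n)"
    using Wr.s_closed assms by auto
  from Wr.presented_hom_in_hom[OF this Wr.eval_coxeter_D_rels]
  have phi: "\<phi> \<in> hom (coxeter_D n) (wreath_D n)"
    and phi_s: "\<And>i. i \<in> {0..n-1} \<Longrightarrow> \<phi> (?s i) = coxeter_D_gen_image n i"
    unfolding \<phi>_def coxeter_D_def coxeter_D_gen_def by auto
  interpret phi: group_hom "coxeter_D n" "wreath_D n" \<phi>
    by unfold_locales (rule phi)

  define \<psi> where "\<psi> = presented_hom (coxeter_D n) Cox.a"
  have "Cox.a ` {1..n-1} \<subseteq> carrier (coxeter_D n)"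
    using Cox.a_closed by auto
  from Cox.presented_hom_in_hom[OF this Cox.eval_alt_pres_rels]
  have psi: "\<psi> \<in> hom (alt_pres n) (coxeter_D n)"
    and psi_gen: "\<And>i. i \<in> {1..n-1} \<Longrightarrow> \<psi> (alt_pres_gen n i) = Cox.a i"
    unfolding \<psi>_def alt_pres_def alt_pres_gen_def by auto
  interpret psi: group_hom "alt_pres n" "coxeter_D n" \<psi>
    by unfold_locales (rule psi)
  define A where "A = \<psi> ` carrier (alt_pres n)"
  have A: "subgroup A (coxeter_D n)"
    unfolding A_def by (rule psi.img_is_subgroup)
  have a_A: "Cox.a i \<in> A" if "i \<in> {1..n-1}" for i
    using psi_gen[OF that] alt_pres_gen_closed[OF that] unfolding A_def by force
  define U where "U = A \<union> (\<lambda>x. x \<otimes>\<^bsub>coxeter_D n\<^esub> ?s 0) ` A"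
  have Cox_U: "carrier (coxeter_D n) \<subseteq> U"
    unfolding U_def by (rule coxeter_D_cosets[OF assms A a_A])
  have finA: "finite A" and cardA: "card A \<le> card (carrier (alt_pres n))"
    using alt_pres_order[OF assms] by (auto simp: A_def card_image_le)
  have finC: "finite (carrier (coxeter_D n))"
    using finA finite_subset[OF Cox_U] by (simp add: U_def)
  have "card (carrier (coxeter_D n)) \<le> card U"
    using finA by (intro card_mono Cox_U) (simp add: U_def)
  also have "\<dots> \<le> card A + card A"
    unfolding U_def using card_image_le[OF finA] by (meson add_left_mono card_Un_le order.trans)
  finally have card_le: "card (carrier (coxeter_D n)) \<le> 2 * card A" by simp

  define I where "I = \<phi> ` carrier (coxeter_D n)"
  have I_sub: "I \<subseteq> carrier (wreath_D n)" by (auto simp: I_def)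
  interpret W: group "C2_wreath n" by (rule C2_wreath_group)
  have I: "subgroup I (C2_wreath n)"
    using phi.img_is_subgroup W.incl_subgroup[OF wreath_D_subgroup, of I]
    by (simp add: I_def wreath_D_def)
  have gen_I: "coxeter_D_gen_image n i \<in> I" if "i < n" for i
    using phi_s[of i] Cox.s_closed[OF that] that unfolding I_def by force
  have I_eq: "I = carrier (wreath_D n)"
    by (rule wreath_D_generated(1)[OF assms I I_sub gen_I])
  have card_ge: "2 ^ n * fact n \<le> 2 * card I"
    by (rule wreath_D_generated(2)[OF assms I I_sub gen_I])
  have card_I: "card I \<le> card (carrier (coxeter_D n))"
    unfolding I_def using finC by (rule card_image_le)
  \<comment> \<open>The chain of orders closes up: \<open>2\<^sup>n n!\<close> is at most twice the order of \<open>I\<close>, hence at most four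
    times the order of the presented group, which is at most \<open>2\<^sup>n n!\<close>.\<close>
  have "card I = card (carrier (coxeter_D n))" "card A = card (carrier (alt_pres n))"
    using card_ge card_I card_le cardA alt_pres_order(2)[OF assms] four by linarith+
  then have inj_phi: "inj_on \<phi> (carrier (coxeter_D n))"
    and inj_psi: "inj_on \<psi> (carrier (alt_pres n))"
    using finC alt_pres_order(1)[OF assms]
    unfolding I_def A_def by (auto intro: eq_card_imp_inj_on)

  have "coxeter_D_sign \<in> hom (coxeter_D n) sign_img" by (rule coxeter_D_sign_hom)
  then interpret sgn: group_hom "coxeter_D n" sign_img coxeter_D_sign
    by (intro group_hom.intro group_hom_axioms.intro Cox.is_group sign_img_is_group)
  have sgn_s: "coxeter_D_sign (?s i) = - 1" if "i < n" for i
    using coxeter_D_sign_hom(2)[of i n] that by auto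
  have sgn_one: "coxeter_D_sign \<one>\<^bsub>coxeter_D n\<^esub> = 1"
    and sgn_mult: "\<And>x y. \<lbrakk>x \<in> carrier (coxeter_D n); y \<in> carrier (coxeter_D n)\<rbrakk>
      \<Longrightarrow> coxeter_D_sign (x \<otimes>\<^bsub>coxeter_D n\<^esub> y) = coxeter_D_sign x * coxeter_D_sign y"
    using sgn.hom_one sgn.hom_mult by (simp_all only: sign_img_ops)
  have A_eq: "A = kernel (coxeter_D n) sign_img coxeter_D_sign"
  proof
    let ?K = "{x \<in> carrier (alt_pres n). coxeter_D_sign (\<psi> x) = 1}"
    \<comment> \<open>A sign whose cube is \<open>1\<close> is \<open>1\<close>.\<close>
    have sgn_a: "coxeter_D_sign (Cox.a i) = 1" if i: "i \<in> {1..n-1}" for i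
    proof -
      have "coxeter_D_sign (Cox.a i \<otimes>\<^bsub>coxeter_D n\<^esub> Cox.a i \<otimes>\<^bsub>coxeter_D n\<^esub> Cox.a i) = 1"
        unfolding Cox.a_cube[OF i] by (simp add: sign_img_ops)
      moreover have "coxeter_D_sign (Cox.a i) \<in> {-1, 1}"
        using sgn.hom_closed[OF Cox.a_closed[OF i]] by (simp add: sign_img_def)
      ultimately show ?thesis
        using Cox.a_closed[OF i] by (auto simp: sgn_mult sign_img_ops)
    qed
    have inv_one: "coxeter_D_sign (\<psi> (inv\<^bsub>alt_pres n\<^esub> x)) = 1"
      if x: "x \<in> carrier (alt_pres n)" "coxeter_D_sign (\<psi> x) = 1" for x
    proof -
      have "1 = coxeter_D_sign (\<psi> (x \<otimes>\<^bsub>alt_pres n\<^esub> inv\<^bsub>alt_pres n\<^esub> x))"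
        using x by (simp add: sign_img_ops)
      also have "\<dots> = coxeter_D_sign (\<psi> (inv\<^bsub>alt_pres n\<^esub> x))"
        using x by (simp only: psi.hom_mult sgn_mult psi.hom_closed Alt.inv_closed mult_1)
      finally show ?thesis by simp
    qed
    have "carrier (alt_pres n) \<subseteq> ?K"
    proof (rule alt_pres_generated)
      show "\<one>\<^bsub>alt_pres n\<^esub> \<in> ?K" by (simp add: sign_img_ops)
      fix u i assume u: "u \<in> ?K" and i: "i \<in> {1..n-1}"
      have g: "alt_pres_gen n i \<in> ?K" using alt_pres_gen_closed[OF i] psi_gen[OF i] sgn_a[OF i] by simp
      then show "u \<otimes>\<^bsub>alt_pres n\<^esub> alt_pres_gen n i \<in> ?K"
        using u by (simp add: sgn_mult sign_img_ops)
      show "u \<otimes>\<^bsub>alt_pres n\<^esub> inv\<^bsub>alt_pres n\<^esub> alt_pres_gen n i \<in> ?K"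
        using u g inv_one[of "alt_pres_gen n i"]
        by (simp add: sgn_mult sign_img_ops del: psi.hom_inv)
    qed
    then show A_sub: "A \<subseteq> kernel (coxeter_D n) sign_img coxeter_D_sign"
      by (auto simp: A_def kernel_def sign_img_def)
    show "kernel (coxeter_D n) sign_img coxeter_D_sign \<subseteq> A"
    proof
      fix x assume "x \<in> kernel (coxeter_D n) sign_img coxeter_D_sign"
      then have x: "x \<in> carrier (coxeter_D n)" "coxeter_D_sign x = 1"
        by (auto simp: kernel_def sign_img_def)
      show "x \<in> A"
      proof (rule ccontr)
        assume "x \<notin> A"
        then obtain v where v: "v \<in> A" "x = v \<otimes>\<^bsub>coxeter_D n\<^esub> ?s 0"
          using Cox_U x by (auto simp: U_def)
        then have "coxeter_D_sign v = 1" using A_sub by (auto simp: kernel_def sign_img_def)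
        then have "coxeter_D_sign x = - 1"
          using v assms sgn_s[of 0] Cox.s012 subgroup.mem_carrier[OF A, of v]
          by (simp add: sgn_mult sign_img_ops)
        then show False using x by simp
      qed
    qed
  qed
  have phi_sgn: "sign (snd (\<phi> x)) = coxeter_D_sign x" if "x \<in> carrier (coxeter_D n)" for x
  proof -
    let ?K = "{x \<in> carrier (coxeter_D n). sign (snd (\<phi> x)) = coxeter_D_sign x}"
    have sign_snd: "sign (snd (y \<otimes>\<^bsub>wreath_D n\<^esub> z)) = sign (snd y) * sign (snd z)"
      if "y \<in> carrier (wreath_D n)" "z \<in> carrier (wreath_D n)" for y z
    proof -
      have "permutation (snd y)" "permutation (snd z)"
        using that by (auto simp: wreath_D_def C2_wreath_carrier
          intro!: permutes_imp_permutation[of "{1..n}"])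
      then show ?thesis
        by (cases y; cases z) (simp add: wreath_D_mult C2_wreath_mult sign_compose)
    qed
    have s: "?s i \<in> ?K" if i: "i < n" for i
    proof -
      have "sign (snd (coxeter_D_gen_image n i)) = - 1"
        using gen_image_pos[of i n] by (cases "i = 0") (auto simp: gen_image_0 sign_swap_id)
      then show ?thesis using phi_s[of i] sgn_s[OF i] Cox.s_closed[OF i] i by simp
    qed
    have "carrier (coxeter_D n) \<subseteq> ?K"
    proof (rule coxeter_D_generated[OF assms])
      show "\<one>\<^bsub>coxeter_D n\<^esub> \<in> ?K"
        by (simp add: sign_img_ops wreath_D_one C2_wreath_one)
      show "u \<otimes>\<^bsub>coxeter_D n\<^esub> ?s i \<in> ?K" if "u \<in> ?K" "i < n" for u i
        using that(1) s[OF that(2)] by (simp add: sign_snd sgn_mult sign_img_ops)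
    qed
    then show ?thesis using that by blast
  qed
  have "\<phi> ` carrier (alternating_D n) = carrier (wreath_D_plus n)"
  proof -
    have "carrier (wreath_D_plus n) = {y \<in> carrier (wreath_D n). sign (snd y) = 1}"
      by (auto simp: wreath_D_plus_def wreath_D_def)
    also have "\<dots> = \<phi> ` {x \<in> carrier (coxeter_D n). coxeter_D_sign x = 1}"
      unfolding I_eq[symmetric] I_def using phi_sgn by auto
    finally show ?thesis
      by (simp add: alternating_D_def kernel_def sign_img_def)
  qed
  moreover have "\<phi> \<in> iso (coxeter_D n) (wreath_D n)"
    using phi inj_phi I_eq unfolding iso_def bij_betw_def I_def by simp
  moreover have "\<psi> \<in> iso (alt_pres n) (alternating_D n)"
    using psi inj_psi A_eq unfolding iso_def bij_betw_def alternating_D_def A_def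
    by (auto simp: hom_def)
  moreover have "\<phi> (\<psi> (alt_pres_gen n i)) = alt_pres_gen_image n i" if i: "i \<in> {1..n-1}" for i
  proof -
    have "\<phi> (Cox.r k) = Wr.r k" if "k + 2 < n" for k
      using that
    proof (induction k)
      case 0
      then show ?case using phi_s[of 2] by simp
    next
      case (Suc k)
      then show ?case using phi_s[of "k + 3"] Cox.s_closed[of "k + 3"] Cox.r_closed[of k] by simp
    qed
    then have "\<phi> (Cox.a i) = Wr.a i"
      using i assms phi_s Cox.s012 Cox.r_closed[of 0] Cox.r_closed[of "i - 2"]
      by (auto simp: Cox.a_def Wr.a_def Cox.d_def Wr.d_def Cox.e_def Wr.e_def)
    then show ?thesis using psi_gen[OF i] wreath_a[OF assms i] by simp
  qed
  ultimately show ?thesis using phi_s by blast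
qed

end
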